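(* Consider the following two variants of local bootstrap percolation. (a) The modified local model. (b) The Froböse local model. For each of these two models there exist constants $c,C,p_0>0$ such that for all $p\in(0,p_0)$, $$ \exp\frac{-2\lambda+c\sqrt p}{p}\;\le\;\mathbb{P}_p\big(\text{indefinite growth}\big)\;\le\;\exp\frac{-2\lambda+C\sqrt p\,(\log p^{-1})^3}{p}, $$ where now $\lambda=\pi^2/6$. Moreover, for the Froböse local model the upper bound can be improved to $\exp\big[(-2\lambda+C\sqrt p\,(\log p^{-1})^2)/p\big]$.
   Context: Each site of $\mathbb{Z}^2$ is at each time $t=0,1,2,\dots$ empty ($\circ$), occupied ($\bullet$) or active ($\star$). The initial configuration is random with law $\mathbb{P}_p$, $p\in(0,1)$: states of different sites are independent; the origin is $\star$ with probability $p$ and $\circ$ otherwise; every other site is $\bullet$ with probability $p$ and $\circ$ otherwise. Updates are deterministic and synchronous. In both models: each $\circ$ becomes $\star$ if it has at least two $\star$'s within $\ell^1$-distance $1$, and states not covered by the rules remain unchanged. In the modified local model, each $\bullet$ becomes $\star$ if it has at least one $\star$ within $\ell^\infty$-distance $1$. In the Froböse local model, each $\bullet$ becomes $\star$ if it has at least one $\star$ within $\ell^1$-distance $1$. "Indefinite growth" is the event that every site of $\mathbb{Z}^2$ eventually becomes active. *)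

theory Defs
  imports "HOL-Probability.Probability"
begin

datatype state = Empty | Occupied | Active

datatype model = Modified | Frobose

type_synonym site = "int \<times> int"
type_synonym config = "site \<Rightarrow> state"

definition l1dist :: "site \<Rightarrow> site \<Rightarrow> int" where
  "l1dist x y = \<bar>fst x - fst y\<bar> + \<bar>snd x - snd y\<bar>"

definition linfdist :: "site \<Rightarrow> site \<Rightarrow> int" where
  "linfdist x y = max \<bar>fst x - fst y\<bar> \<bar>snd x - snd y\<bar>"

definition occ_dist :: "model \<Rightarrow> site \<Rightarrow> site \<Rightarrow> int" where
  "occ_dist m = (case m of Modified \<Rightarrow> linfdist | Frobose \<Rightarrow> l1dist)"

definition step :: "model \<Rightarrow> config \<Rightarrow> config" where
  "step m \<sigma> x =
     (case \<sigma> x of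
        Empty \<Rightarrow> (if card {y. l1dist y x \<le> 1 \<and> \<sigma> y = Active} \<ge> 2 then Active else Empty)
      | Occupied \<Rightarrow> (if \<exists>y. occ_dist m y x \<le> 1 \<and> \<sigma> y = Active then Active else Occupied)
      | Active \<Rightarrow> Active)"

definition evolve :: "model \<Rightarrow> nat \<Rightarrow> config \<Rightarrow> config" where
  "evolve m t \<sigma> = (step m ^^ t) \<sigma>"

definition indefinite_growth :: "model \<Rightarrow> config \<Rightarrow> bool" where
  "indefinite_growth m \<sigma> \<longleftrightarrow> (\<forall>x. \<exists>t. evolve m t \<sigma> x = Active)"

definition site_law :: "real \<Rightarrow> site \<Rightarrow> state pmf" where
  "site_law p x = map_pmf (\<lambda>b. if b then (if x = (0,0) then Active else Occupied) else Empty)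
                          (bernoulli_pmf p)"

definition init_law :: "real \<Rightarrow> config measure" where
  "init_law p = (\<Pi>\<^sub>M x\<in>UNIV. measure_pmf (site_law p x))"

definition prob_growth :: "model \<Rightarrow> real \<Rightarrow> real" where
  "prob_growth m p = measure (init_law p) {\<sigma> \<in> space (init_law p). indefinite_growth m \<sigma>}"

end

theory Submission
  imports Defs
begin

text \<open>Write $f(n) = 1 - (1-p)^n$ for the probability that a line of $n$ sites is not entirely empty.
  Since $\sum_n -\log f(n) = \pi^2 / (6p) + O(p^{-1/2})$, growing a square from the origin one line at
  a time has probability about $\exp(-2 \pi^2 / (6p))$.

  Upper bound: growth forces every rectangle around the origin to have a filled site on its rim. A
  maximality argument extends a rectangle $m \times n$ by about a fraction $\sqrt p$ in one direction,
  all new lines being filled; corners cost only a bounded factor, and the number of possible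
  extensions is polynomial in $1/p$. So $p^{-1/2} \log(1/p)$ extensions carry an entropy of
  $p^{-1/2} \log^2(1/p)$, while convexity of $-\log f$ makes the diagonal the cheapest path. The rim
  includes corners, so that the argument is the same for both models.

  Lower bound: between sizes $1/p$ and $2/p$ there are about $p^{-1/2}$ disjoint blocks of length about
  $p^{-1/2}$; in each of them, non-diagonal routes increase the probability by a constant factor.\<close>

subsection \<open>Independence of events on disjoint sets of sites\<close>

text \<open>The upper bound needs no optimisation over growth paths: \<open>potential\<close> rises
  by at most the cost of each added line, so its rise bounds the cost of every path from below.
  Entropy is charged likewise: \<open>step_budget\<close> is the integral of
  \<open>1 / speed\<close> from the current side length to twice the cutoff, and each extension uses
  up at least 1/2 of it. As \<open>1 / speed p x = (1/x + p) / sqrt p\<close>, the integral is of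
  order \<open>p^(-1/2) log(1/p)\<close>, and the induction carries one explicit function,
  \<open>growth_bound\<close>. The obstacle is that a new row and a new column share corner sites,
  so their events are not independent; this limits how many lines one extension may add and thereby
  fixes \<open>speed\<close>. In the lower bound, detours are disjoint from the diagonal route and
  from one another, so their probabilities add. A block of length L offers about L^2 places for the
  decisive site, each filled with probability p; hence L of order \<open>p^(-1/2)\<close> gives a
  gain bounded below. Over such a block at scale \<open>1/p\<close>, replacing all line lengths by
  the initial one changes the probability only by a bounded factor.\<close>

definition depends_on :: "config set \<Rightarrow> site set \<Rightarrow> bool" where
  "depends_on X I \<longleftrightarrow> (\<forall>\<sigma> \<tau>. (\<forall>i\<in>I. \<sigma> i = \<tau> i) \<longrightarrow> \<sigma> \<in> X \<longrightarrow> \<tau> \<in> X)"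

lemma depends_onD: "depends_on X I \<Longrightarrow> (\<And>i. i \<in> I \<Longrightarrow> \<sigma> i = \<tau> i) \<Longrightarrow> \<sigma> \<in> X \<longleftrightarrow> \<tau> \<in> X"
  unfolding depends_on_def by (metis (full_types))

lemma depends_on_mono: "depends_on X I \<Longrightarrow> I \<subseteq> J \<Longrightarrow> depends_on X J"
  unfolding depends_on_def by blast

lemma depends_on_Int: "depends_on X I \<Longrightarrow> depends_on Y J \<Longrightarrow> depends_on (X \<inter> Y) (I \<union> J)"
  unfolding depends_on_def by (metis IntD1 IntD2 IntI UnI1 UnI2)

lemma depends_on_INT: "(\<And>j. j \<in> A \<Longrightarrow> depends_on (X j) (I j)) \<Longrightarrow> depends_on (\<Inter>j\<in>A. X j) (\<Union>j\<in>A. I j)"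
  unfolding depends_on_def by (smt (verit) INT_iff UN_iff)

lemma depends_on_UN: "(\<And>j. j \<in> A \<Longrightarrow> depends_on (X j) (I j)) \<Longrightarrow> depends_on (\<Union>j\<in>A. X j) (\<Union>j\<in>A. I j)"
  unfolding depends_on_def by (smt (verit) UN_iff)

lemma depends_on_Un: "depends_on X I \<Longrightarrow> depends_on Y J \<Longrightarrow> depends_on (X \<union> Y) (I \<union> J)"
  unfolding depends_on_def by (metis Un_iff)

lemma space_init_law [simp]: "space (init_law p) = UNIV"
  by (simp add: init_law_def space_PiM PiE_UNIV_domain)

lemma sets_init_law: "sets (init_law p) = sets (\<Pi>\<^sub>M x\<in>(UNIV::site set). count_space (UNIV::state set))"
  unfolding init_law_def by (rule sets_PiM_cong) simp_all

lemma prob_space_init_law: "prob_space (init_law p)"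
  unfolding init_law_def by (rule prob_space_PiM) (rule measure_pmf.prob_space_axioms)

lemma UNIV_state: "(UNIV :: state set) = {Empty, Occupied, Active}"
  using state.exhaust by auto

lemma coordinate_event_measurable: "{\<sigma>. P (\<sigma> x)} \<in> sets (init_law p)"
proof -
  have "(\<lambda>\<sigma>. \<sigma> x) \<in> measurable (init_law p) (count_space UNIV)"
    unfolding measurable_cong_sets[OF sets_init_law refl]
    by (rule measurable_component_singleton) simp
  from measurable_sets[OF this, of "{s. P s}"] show ?thesis
    by (simp add: vimage_def)
qed

text \<open>Finitely many sites carry finitely many patterns, so any such set, however defined, is a
  finite union of cylinders.\<close>

lemma depends_on_finite_measurable:
  assumes "finite I" "depends_on X I"
  shows "X \<in> sets (init_law p)"
proof -
  let ?C = "(\<lambda>\<sigma>. restrict \<sigma> I) ` X"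
  have "?C \<subseteq> PiE I (\<lambda>_. UNIV)" by auto
  moreover have "finite (PiE I (\<lambda>_. UNIV :: state set))"
    by (rule finite_PiE) (use assms(1) in \<open>simp_all add: UNIV_state\<close>)
  ultimately have fin: "finite ?C" by (rule finite_subset)
  have "X = (\<Union>\<tau>\<in>?C. \<Inter>i\<in>I. {\<sigma>. \<sigma> i = \<tau> i}) " (is "_ = ?R")
  proof
    show "X \<subseteq> ?R" by auto
    show "?R \<subseteq> X"
    proof
      fix \<sigma> assume "\<sigma> \<in> ?R"
      then obtain \<rho> where "\<rho> \<in> X" "\<And>i. i \<in> I \<Longrightarrow> \<sigma> i = restrict \<rho> I i" by auto
      with depends_onD[OF assms(2), of \<rho> \<sigma>] show "\<sigma> \<in> X" by simp
    qed
  qed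
  moreover have "(\<Inter>i\<in>I. {\<sigma>. \<sigma> i = \<tau> i}) \<in> sets (init_law p)" for \<tau>
  proof (cases "I = {}")
    case True
    then show ?thesis using sets.top[of "init_law p"] by simp
  next
    case False
    then show ?thesis
      by (intro sets.finite_INT assms) (auto intro: coordinate_event_measurable)
  qed
  then have "?R \<in> sets (init_law p)"
    using fin by (intro sets.finite_UN) auto
  ultimately show ?thesis by simp
qed

text \<open>\<open>I\<close> and \<open>J\<close> may be infinite: \<open>never_stuck\<close> and
  the final phase of diagonal growth depend on the whole complement of a rectangle. The coordinates
  are independent, hence so are the two restrictions of the configuration, and each event is a
  preimage under its restriction.\<close>

lemma indep_depends_on:
  assumes X: "X \<in> sets (init_law p)" "depends_on X I"
    and Y: "Y \<in> sets (init_law p)" "depends_on Y J" and disj: "I \<inter> J = {}"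
  shows "measure (init_law p) (X \<inter> Y) = measure (init_law p) X * measure (init_law p) Y"
proof -
  interpret prob_space "init_law p" by (rule prob_space_init_law)
  let ?N = "\<lambda>x. measure_pmf (site_law p x)"
  have meas: "(\<lambda>\<sigma>. \<sigma> i) \<in> measurable (init_law p) (?N i)" for i
    unfolding init_law_def by (rule measurable_component_singleton) simp
  have "indep_vars ?N (\<lambda>i \<sigma>. \<sigma> i) UNIV"
  proof (subst indep_vars_iff_distr_eq_PiM)
    have "distr (init_law p) (?N i) (\<lambda>\<sigma>. \<sigma> i) = ?N i" for i
      unfolding init_law_def
      by (rule distr_PiM_component) (auto intro: measure_pmf.prob_space_axioms)
    then show "distr (init_law p) (Pi\<^sub>M UNIV ?N) (\<lambda>\<sigma>. \<lambda>i\<in>UNIV. \<sigma> i) =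
        Pi\<^sub>M UNIV (\<lambda>i. distr (init_law p) (?N i) (\<lambda>\<sigma>. \<sigma> i))"
      by (simp add: restrict_UNIV) (simp add: init_law_def)
  qed (use meas in auto)
  from indep_var_restrict[OF this disj]
  have ind: "indep_var (PiM I ?N) (\<lambda>\<sigma>. restrict \<sigma> I) (PiM J ?N) (\<lambda>\<sigma>. restrict \<sigma> J)"
    by simp
  \<comment> \<open>Filling the missing sites with \<open>Empty\<close> turns a restriction back
    into a configuration. An event determined by \<open>K\<close> cannot notice the filling, so it
    is pulled back from a measurable set of restrictions.\<close>
  define ext :: "site set \<Rightarrow> config \<Rightarrow> config" where "ext = (\<lambda>K \<tau> i. if i \<in> K then \<tau> i else Empty)"
  have ext: "ext K \<in> measurable (PiM K ?N) (init_law p)" for K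
    unfolding init_law_def
  proof (rule measurable_PiM_single')
    fix i show "(\<lambda>\<tau>. ext K \<tau> i) \<in> measurable (PiM K ?N) (?N i)"
      by (cases "i \<in> K") (simp_all add: ext_def measurable_component_singleton[of i K ?N, simplified])
  qed auto
  have pull: "Z = (\<lambda>\<sigma>. restrict \<sigma> K) -` (ext K -` Z \<inter> space (PiM K ?N)) \<inter> space (init_law p)"
    if "depends_on Z K" for Z K
  proof -
    have "ext K (restrict \<sigma> K) \<in> Z \<longleftrightarrow> \<sigma> \<in> Z" for \<sigma>
      by (rule depends_onD[OF that]) (simp add: ext_def)
    then show ?thesis by (auto simp: space_PiM)
  qed
  have "prob ((\<lambda>\<sigma>. (restrict \<sigma> I, restrict \<sigma> J)) -`
      ((ext I -` X \<inter> space (PiM I ?N)) \<times> (ext J -` Y \<inter> space (PiM J ?N))) \<inter> space (init_law p)) =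
    prob ((\<lambda>\<sigma>. restrict \<sigma> I) -` (ext I -` X \<inter> space (PiM I ?N)) \<inter> space (init_law p)) *
    prob ((\<lambda>\<sigma>. restrict \<sigma> J) -` (ext J -` Y \<inter> space (PiM J ?N)) \<inter> space (init_law p))"
    by (rule indep_varD[OF ind measurable_sets[OF ext X(1)] measurable_sets[OF ext Y(1)]])
  also have "(\<lambda>\<sigma>. (restrict \<sigma> I, restrict \<sigma> J)) -`
      ((ext I -` X \<inter> space (PiM I ?N)) \<times> (ext J -` Y \<inter> space (PiM J ?N))) \<inter> space (init_law p) =
      ((\<lambda>\<sigma>. restrict \<sigma> I) -` (ext I -` X \<inter> space (PiM I ?N)) \<inter> space (init_law p)) \<inter>
      ((\<lambda>\<sigma>. restrict \<sigma> J) -` (ext J -` Y \<inter> space (PiM J ?N)) \<inter> space (init_law p))" by auto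
  finally show ?thesis
    unfolding pull[OF X(2), symmetric] pull[OF Y(2), symmetric] .
qed

lemma indep_depends_on_family:
  assumes "finite A" "\<And>j. j \<in> A \<Longrightarrow> finite (I j)" "\<And>j. j \<in> A \<Longrightarrow> depends_on (X j) (I j)"
    "disjoint_family_on I A"
  shows "measure (init_law p) (\<Inter>j\<in>A. X j) = (\<Prod>j\<in>A. measure (init_law p) (X j))"
  using assms
proof (induction A rule: finite_induct)
  case empty
  interpret prob_space "init_law p" by (rule prob_space_init_law)
  show ?case using prob_space by simp
next
  case (insert a A)
  have "depends_on (\<Inter>j\<in>A. X j) (\<Union>j\<in>A. I j)" by (rule depends_on_INT) (use insert.prems in auto)
  moreover have "finite (\<Union>j\<in>A. I j)" using insert by auto
  ultimately have "measure (init_law p) (X a \<inter> (\<Inter>j\<in>A. X j)) =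
      measure (init_law p) (X a) * measure (init_law p) (\<Inter>j\<in>A. X j)"
    using insert.prems insert.hyps
    by (intro indep_depends_on[where I="I a" and J="\<Union>j\<in>A. I j"] depends_on_finite_measurable[where I="I a"]
         depends_on_finite_measurable[where I="\<Union>j\<in>A. I j"]) (auto simp: disjoint_family_on_def)
  moreover have "measure (init_law p) (\<Inter>j\<in>A. X j) = (\<Prod>j\<in>A. measure (init_law p) (X j))"
    by (rule insert.IH) (use insert.prems in \<open>auto simp: disjoint_family_on_def\<close>)
  ultimately show ?case using insert.hyps by simp
qed

section \<open>Probabilities of filled and empty sets of sites\<close>

definition some_filled :: "site set \<Rightarrow> config set" where
  "some_filled S = {\<sigma>. \<exists>x\<in>S. \<sigma> x \<noteq> Empty}"

definition all_empty :: "site set \<Rightarrow> config set" where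
  "all_empty S = {\<sigma>. \<forall>x\<in>S. \<sigma> x = Empty}"

lemma depends_some_filled: "depends_on (some_filled S) S"
  unfolding depends_on_def some_filled_def by auto

lemma depends_all_empty: "depends_on (all_empty S) S"
  unfolding depends_on_def all_empty_def by auto

lemma some_filled_measurable: "finite S \<Longrightarrow> some_filled S \<in> sets (init_law p)"
  using depends_on_finite_measurable depends_some_filled by blast

lemma all_empty_measurable: "finite S \<Longrightarrow> all_empty S \<in> sets (init_law p)"
  using depends_on_finite_measurable depends_all_empty by blast

lemma prob_site:
  assumes "0 \<le> p" "p \<le> 1"
  shows "measure (site_law p x) {Empty} = 1 - p"
proof -
  have "(\<lambda>b. if b then (if x = (0,0) then Active else Occupied) else Empty) -` {Empty} = {False}"
    by (auto split: if_splits)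
  then show ?thesis
    unfolding site_law_def measure_map_pmf using assms by (simp add: measure_pmf_single)
qed

lemma prob_all_empty:
  assumes "0 \<le> p" "p \<le> 1" "finite S"
  shows "measure (init_law p) (all_empty S) = (1 - p) ^ card S"
proof -
  have "measure (init_law p) (\<Inter>x\<in>S. all_empty {x}) = (\<Prod>x\<in>S. measure (init_law p) (all_empty {x}))"
    by (rule indep_depends_on_family[where I="\<lambda>x. {x}"])
       (use assms in \<open>auto simp: depends_all_empty disjoint_family_on_def\<close>)
  moreover have "measure (init_law p) (all_empty {x}) = 1 - p" for x
  proof -
    have "all_empty {x} = (\<lambda>\<sigma>. \<sigma> x) -` {Empty} \<inter> space (init_law p)" by (auto simp: all_empty_def)
    moreover have "distr (init_law p) (site_law p x) (\<lambda>\<sigma>. \<sigma> x) = site_law p x"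
      unfolding init_law_def by (rule distr_PiM_component) (auto intro: measure_pmf.prob_space_axioms)
    moreover have "(\<lambda>\<sigma>. \<sigma> x) \<in> measurable (init_law p) (site_law p x)"
      unfolding init_law_def by (rule measurable_component_singleton) simp
    ultimately show ?thesis
      using measure_distr[of "\<lambda>\<sigma>. \<sigma> x" "init_law p" "site_law p x" "{Empty}"] prob_site[OF assms(1,2)]
      by simp
  qed
  moreover have "(\<Inter>x\<in>S. all_empty {x}) = all_empty S" by (auto simp: all_empty_def)
  ultimately show ?thesis by simp
qed

definition fill_prob :: "real \<Rightarrow> nat \<Rightarrow> real" where
  "fill_prob p n = 1 - (1 - p) ^ n"

lemma prob_some_filled:
  assumes "0 \<le> p" "p \<le> 1" "finite S"
  shows "measure (init_law p) (some_filled S) = fill_prob p (card S)"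
proof -
  interpret prob_space "init_law p" by (rule prob_space_init_law)
  have "some_filled S = space (init_law p) - all_empty S"
    by (auto simp: some_filled_def all_empty_def)
  then show ?thesis
    using prob_compl[OF all_empty_measurable[OF assms(3)]] prob_all_empty[OF assms]
    by (simp add: fill_prob_def)
qed

lemma prob_Inter_some_filled:
  assumes "0 \<le> p" "p \<le> 1" "finite A" "\<And>j. j \<in> A \<Longrightarrow> finite (S j)" "disjoint_family_on S A"
  shows "measure (init_law p) (\<Inter>j\<in>A. some_filled (S j)) = (\<Prod>j\<in>A. fill_prob p (card (S j)))"
  using indep_depends_on_family[of A S "\<lambda>j. some_filled (S j)" p] assms
  by (simp add: depends_some_filled prob_some_filled)

lemma depends_Inter_some_filled: "depends_on (\<Inter>j\<in>A. some_filled (S j)) (\<Union>j\<in>A. S j)"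
  by (rule depends_on_INT) (rule depends_some_filled)

text \<open>The product space contains configurations with \<open>Active\<close> away from the
  origin or \<open>Occupied\<close> at it. They form a null set, outside which the pointwise growth
  arguments apply.\<close>

lemma AE_only_origin_active: "AE \<sigma> in init_law p. \<forall>x. (\<sigma> x = Active \<longrightarrow> x = (0,0)) \<and> (\<sigma> x = Occupied \<longrightarrow> x \<noteq> (0,0))"
proof (subst AE_all_countable, intro allI)
  fix x
  have "AE s in measure_pmf (site_law p x). (s = Active \<longrightarrow> x = (0,0)) \<and> (s = Occupied \<longrightarrow> x \<noteq> (0,0))"
    unfolding AE_measure_pmf_iff by (auto simp: site_law_def split: if_splits)
  then show "AE \<sigma> in init_law p. (\<sigma> x = Active \<longrightarrow> x = (0,0)) \<and> (\<sigma> x = Occupied \<longrightarrow> x \<noteq> (0,0))"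
    unfolding init_law_def by (rule AE_PiM_component[rotated 2]) (auto intro: measure_pmf.prob_space_axioms)
qed

lemma fill_prob_mono: "0 \<le> p \<Longrightarrow> p \<le> 1 \<Longrightarrow> m \<le> n \<Longrightarrow> fill_prob p m \<le> fill_prob p n"
  unfolding fill_prob_def by (simp add: power_decreasing)

lemma fill_prob_nonneg: "0 \<le> p \<Longrightarrow> p \<le> 1 \<Longrightarrow> 0 \<le> fill_prob p n"
  unfolding fill_prob_def by (simp add: power_le_one)

lemma fill_prob_le_1: "0 \<le> p \<Longrightarrow> p \<le> 1 \<Longrightarrow> fill_prob p n \<le> 1"
  unfolding fill_prob_def by simp

lemma fill_prob_pos: "0 < p \<Longrightarrow> p \<le> 1 \<Longrightarrow> 0 < n \<Longrightarrow> 0 < fill_prob p n"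
  using fill_prob_mono[of p 1 n] by (simp add: fill_prob_def)

lemma fill_prob_1 [simp]: "fill_prob p (Suc 0) = p"
  by (simp add: fill_prob_def)

subsection \<open>The cost of adding lines\<close>

definition cost :: "real \<Rightarrow> nat \<Rightarrow> real" where
  "cost p n = - ln (fill_prob p n)"

lemma exp_cost: "0 < p \<Longrightarrow> p \<le> 1 \<Longrightarrow> 0 < n \<Longrightarrow> exp (- cost p n) = fill_prob p n"
  unfolding cost_def using fill_prob_pos by simp

lemma cost_nonneg: "0 < p \<Longrightarrow> p \<le> 1 \<Longrightarrow> 0 < n \<Longrightarrow> 0 \<le> cost p n"
  unfolding cost_def using fill_prob_pos[of p n] fill_prob_le_1[of p n] by simp

lemma cost_antimono: "0 < p \<Longrightarrow> p \<le> 1 \<Longrightarrow> 0 < m \<Longrightarrow> m \<le> n \<Longrightarrow> cost p n \<le> cost p m"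
  unfolding cost_def using fill_prob_mono[of p m n] fill_prob_pos[of p m] by simp

lemma cost_Suc_0 [simp]: "cost p (Suc 0) = - ln p"
  by (simp add: cost_def)

text \<open>Log-concavity of \<open>f = fill_prob p\<close>: the defect
  \<open>f(j+1)^2 - f(j) f(j+2)\<close> equals \<open>(1-p)^j p^2\<close>.\<close>

lemma cost_convex:
  assumes "0 < p" "p < 1" "0 < j"
  shows "cost p (Suc j) - cost p j \<le> cost p (Suc (Suc j)) - cost p (Suc j)"
proof -
  have pos: "0 < fill_prob p k" if "0 < k" for k using that assms fill_prob_pos by simp
  have "fill_prob p j * fill_prob p (Suc (Suc j)) = (fill_prob p (Suc j))\<^sup>2 - (1 - p) ^ j * p\<^sup>2"
    unfolding fill_prob_def by (simp add: algebra_simps power2_eq_square)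
  also have "\<dots> \<le> (fill_prob p (Suc j))\<^sup>2" using assms by simp
  finally have "ln (fill_prob p j * fill_prob p (Suc (Suc j))) \<le> ln ((fill_prob p (Suc j))\<^sup>2)"
    using pos assms(3) by (intro ln_mono mult_pos_pos) auto
  then show ?thesis
    using pos[of j] pos[of "Suc j"] pos[of "Suc (Suc j)"] assms(3)
    by (simp add: cost_def ln_mult ln_realpow)
qed

text \<open>Slopes of a convex sequence increase, so the line through its points at \<open>m\<close>
  and \<open>m + 1\<close> stays below it further on. This is the form in which convexity of the
  cost enters \<open>potential_Suc\<close>.\<close>

lemma cost_above_secant:
  assumes "0 < p" "p < 1" "0 < m"
  shows "cost p m + real d * (cost p (Suc m) - cost p m) \<le> cost p (m + d)"
proof (induction d)
  case (Suc d)
  have slope: "cost p (Suc m) - cost p m \<le> cost p (Suc (m + e)) - cost p (m + e)" for e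
  proof (induction e)
    case (Suc e)
    then show ?case using cost_convex[OF assms(1,2), of "m + e"] assms(3) by simp
  qed simp
  show ?case using Suc.IH slope[of d] by (simp add: algebra_simps)
qed simp

lemma ln_one_minus_scale:
  assumes "0 \<le> t" "t \<le> 1" "0 \<le> u" "u < (1::real)"
  shows "- ln (1 - t * u) \<le> t * - ln (1 - u)"
proof -
  have "t * ln (1 - u) + (1 - t) * ln 1 \<le> ln (t * (1 - u) + (1 - t) * 1)"
    using concave_onD[OF ln_concave, of "1 - t" "1 - u" 1] assms by (simp add: algebra_simps)
  then show ?thesis by (simp add: algebra_simps)
qed

text \<open>\<open>-ln(1 - u)\<close> is convex and vanishes at 0, so shrinking
  \<open>u = (1-p)^n\<close> by a factor shrinks it at least as much. The geometric decay makes the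
  costs summable and their tails explicit.\<close>

lemma cost_decay:
  assumes "0 < p" "p < 1" "0 < n"
  shows "cost p (n + i) \<le> (1 - p) ^ i * cost p n"
proof -
  have "(1 - p) ^ n < 1" using assms by (simp add: power_less_one_iff)
  then show ?thesis
    using ln_one_minus_scale[of "(1 - p) ^ i" "(1 - p) ^ n"] assms
    by (simp add: cost_def fill_prob_def power_add mult.commute power_le_one)
qed

lemma cost_le_ratio:
  assumes "0 < p" "p < 1" "0 < n"
  shows "cost p n \<le> (1 - p) ^ n / (1 - (1 - p) ^ n)"
proof -
  have pos: "0 < 1 - (1 - p) ^ n" using assms by (simp add: power_less_one_iff)
  have "- ln (1 - (1 - p) ^ n) = ln (1 / (1 - (1 - p) ^ n))" using pos by (simp add: ln_div)
  also have "\<dots> \<le> 1 / (1 - (1 - p) ^ n) - 1" using pos by (intro ln_le_minus_one) simp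
  also have "\<dots> = (1 - p) ^ n / (1 - (1 - p) ^ n)" using pos by (simp add: field_simps)
  finally show ?thesis by (simp add: cost_def fill_prob_def)
qed

section \<open>Power series of the cost and the constant pi^2/6\<close>

lemma cost_series:
  assumes "0 < p" "p < 1" "0 < j"
  shows "(\<lambda>k. ((1 - p) ^ j) ^ Suc k / real (Suc k)) sums cost p j"
proof -
  have lt: "(1 - p) ^ j < 1" using assms by (simp add: power_less_one_iff)
  have ge: "0 \<le> (1 - p) ^ j" using assms by simp
  have "(\<lambda>n. - ((- (- ((1 - p) ^ j))) ^ n) / of_nat n) sums ln (1 + - ((1 - p) ^ j))"
    by (rule ln_series') (use lt ge in simp)
  from sums_minus[OF this] have "(\<lambda>n. ((1 - p) ^ j) ^ n / of_nat n) sums cost p j"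
    by (simp add: cost_def fill_prob_def)
  then show ?thesis
    by (subst sums_Suc_iff) simp
qed

text \<open>The left side is the sum of the powers of \<open>(1-p)^n\<close> for
  \<open>n = Suc k\<close>. The bound follows from \<open>(1-p)^n (1+p)^n <= 1\<close> and the
  Bernoulli inequality for \<open>(1+p)^n\<close>.\<close>

lemma geometric_ratio_upper:
  assumes "0 < p" "p < (1::real)"
  shows "(1 - p) ^ Suc k / (1 - (1 - p) ^ Suc k) \<le> 1 / (p * Suc k)"
proof -
  have pos: "0 < 1 - (1 - p) ^ Suc k" using assms by (simp add: power_less_one_iff del: power_Suc)
  have "(1 - p) ^ Suc k * (1 + Suc k * p) \<le> (1 - p) ^ Suc k * (1 + p) ^ Suc k"
    using Bernoulli_inequality[of p "Suc k"] assms by (intro mult_left_mono) auto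
  also have "\<dots> = (1 - p\<^sup>2) ^ Suc k"
    by (simp add: power_mult_distrib[symmetric] algebra_simps power2_eq_square del: power_Suc)
  also have "\<dots> \<le> 1" using assms by (intro power_le_one) (auto simp: power_le_one)
  finally have "(1 - p) ^ Suc k * (p * Suc k) \<le> 1 - (1 - p) ^ Suc k"
    by (simp add: algebra_simps del: power_Suc)
  then have "(1 - p) ^ Suc k \<le> (1 - (1 - p) ^ Suc k) / (p * Suc k)"
    using assms by (subst pos_le_divide_eq) auto
  then show ?thesis
    using pos by (subst pos_divide_le_eq) auto
qed

lemma power_Suc_swap: "(r ^ Suc j) ^ Suc k = r ^ Suc k * (r ^ Suc k) ^ j" for r :: "'a::monoid_mult"
  by (metis power_mult mult.commute power_Suc)

lemma geometric_ratio_lower: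
  assumes "0 < p" "p < (1::real)"
  shows "1 / (p * Suc k) - 1 \<le> (1 - p) ^ Suc k / (1 - (1 - p) ^ Suc k)"
proof -
  have pos: "0 < 1 - (1 - p) ^ Suc k" using assms by (simp add: power_less_one_iff del: power_Suc)
  have "1 - (1 - p) ^ Suc k \<le> Suc k * p"
    using Bernoulli_inequality[of "- p" "Suc k"] assms by simp
  then have "1 / (p * Suc k) \<le> 1 / (1 - (1 - p) ^ Suc k)"
    using pos assms by (intro divide_left_mono) (auto simp: mult.commute)
  also have "\<dots> = (1 - p) ^ Suc k / (1 - (1 - p) ^ Suc k) + 1"
    using pos by (simp add: field_simps del: power_Suc)
  finally show ?thesis by simp
qed

text \<open>Exchange the sum over lines with the logarithm series: for fixed \<open>k\<close> the
  lines form a geometric series bounded by \<open>1/(p(k+1))\<close>, and the remaining factor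
  \<open>1/(k+1)\<close> produces the Basel series. No error term arises in this direction.\<close>

lemma sum_cost_upper:
  assumes "0 < p" "p < 1"
  shows "(\<Sum>j<J. cost p (Suc j)) \<le> pi\<^sup>2 / 6 / p"
proof (rule sums_le)
  show "(\<lambda>k. \<Sum>j<J. ((1 - p) ^ Suc j) ^ Suc k / real (Suc k)) sums (\<Sum>j<J. cost p (Suc j))"
    by (intro sums_sum cost_series assms) simp
  show "(\<lambda>k. 1 / (real k + 1)\<^sup>2 / p) sums (pi\<^sup>2 / 6 / p)"
    using sums_divide[OF inverse_squares_sums, of p] by (simp add: add.commute)
  fix k
  define \<rho> where "\<rho> = (1 - p) ^ Suc k"
  have \<rho>: "0 < \<rho>" "\<rho> < 1" unfolding \<rho>_def using assms by (auto simp: power_less_one_iff simp del: power_Suc)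
  have "(\<Sum>j<J. ((1 - p) ^ Suc j) ^ Suc k / real (Suc k)) = \<rho> * (\<Sum>j<J. \<rho> ^ j) / Suc k"
    unfolding sum_distrib_left sum_divide_distrib \<rho>_def
    by (intro sum.cong refl) (simp only: power_Suc_swap)
  also have "\<dots> = \<rho> * ((1 - \<rho> ^ J) / (1 - \<rho>)) / Suc k" using \<rho> by (simp add: sum_gp_strict)
  also have "\<dots> \<le> \<rho> * (1 / (1 - \<rho>)) / Suc k"
    using \<rho> by (intro divide_right_mono mult_left_mono divide_right_mono) auto
  also have "\<dots> \<le> 1 / (p * Suc k) / Suc k"
    using geometric_ratio_upper[OF assms, of k] by (intro divide_right_mono) (auto simp: \<rho>_def)
  also have "\<dots> = 1 / (real k + 1)\<^sup>2 / p" by (simp add: power2_eq_square field_simps)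
  finally show "(\<Sum>j<J. ((1 - p) ^ Suc j) ^ Suc k / real (Suc k)) \<le> 1 / (real k + 1)\<^sup>2 / p" .
qed

lemma prod_fill_prob_lower:
  assumes "0 < p" "p < 1"
  shows "exp (- (pi\<^sup>2 / 6) / p) \<le> (\<Prod>j<J. fill_prob p (Suc j))"
proof -
  have "exp (- (pi\<^sup>2 / 6) / p) \<le> exp (\<Sum>j<J. - cost p (Suc j))"
    using sum_cost_upper[OF assms, of J] by (simp add: sum_negf)
  also have "\<dots> = (\<Prod>j<J. fill_prob p (Suc j))"
    unfolding exp_sum[OF finite_lessThan] by (rule prod.cong) (use assms exp_cost in auto)
  finally show ?thesis .
qed

lemma summable_cost:
  assumes "0 < p" "p < 1"
  shows "summable (\<lambda>j. cost p (Suc j))"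
proof (rule summable_comparison_test')
  show "summable (\<lambda>j. (1 - p) ^ j * cost p 1)"
    using assms by (intro summable_mult2 summable_geometric) simp
  show "norm (cost p (Suc j)) \<le> (1 - p) ^ j * cost p 1" if "0 \<le> j" for j
    using cost_decay[OF assms, of 1 j] cost_nonneg[of p "Suc j"] assms by simp
qed

definition total_cost :: "real \<Rightarrow> real" where
  "total_cost p = (\<Sum>j. cost p (Suc j))"

lemma partial_basel:
  assumes "0 < K"
  shows "pi\<^sup>2 / 6 - 1 / K \<le> (\<Sum>k<K. 1 / (real k + 1)\<^sup>2)"
proof -
  \<comment> \<open>Adding \<open>1/(n+1)\<close> makes the partial sums decrease, because
    \<open>1/(n+2)^2 <= 1/(n+1) - 1/(n+2)\<close>; hence they stay above their limit.\<close>
  let ?a = "\<lambda>n. (\<Sum>k<Suc n. 1 / (real k + 1)\<^sup>2) + 1 / real (Suc n)"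
  have "decseq ?a"
  proof (rule decseq_SucI)
    fix n
    have "1 / (real (Suc n) + 1)\<^sup>2 + 1 / real (Suc (Suc n)) \<le> 1 / real (Suc n)"
      by (simp add: divide_simps power2_eq_square) (simp add: algebra_simps)
    then show "?a (Suc n) \<le> ?a n" by simp
  qed
  moreover have "?a \<longlonglongrightarrow> pi\<^sup>2 / 6 + 0"
  proof (rule tendsto_add)
    have "(\<lambda>k. 1 / (real k + 1)\<^sup>2) sums (pi\<^sup>2 / 6)"
      using inverse_squares_sums by (simp add: add.commute)
    then show "(\<lambda>n. \<Sum>k<Suc n. 1 / (real k + 1)\<^sup>2) \<longlonglongrightarrow> pi\<^sup>2 / 6"
      unfolding sums_def by (rule LIMSEQ_Suc)
    show "(\<lambda>n. 1 / real (Suc n)) \<longlonglongrightarrow> 0" using LIMSEQ_inverse_real_of_nat by (simp add: inverse_eq_divide)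
  qed
  ultimately have "pi\<^sup>2 / 6 + 0 \<le> ?a (K - 1)" by (rule decseq_ge)
  then show ?thesis using assms by simp
qed

lemma total_cost_lower:
  assumes "0 < p" "p < 1"
  shows "pi\<^sup>2 / 6 / p - 2 / sqrt p - 1 \<le> total_cost p"
proof -
  \<comment> \<open>Truncating the logarithm series after \<open>K\<close> terms loses
    \<open>1/(Kp)\<close> through the Basel sum and at most 1 in each term kept; \<open>K\<close>
    near \<open>p^(-1/2)\<close> balances the two losses.\<close>
  define K where "K = nat \<lceil>1 / sqrt p\<rceil>"
  have K: "1 / sqrt p \<le> K" "K \<le> 1 / sqrt p + 1" "0 < K"
    unfolding K_def using assms by (auto intro: less_le_trans simp: less_ceiling_iff)
  have geo: "(\<lambda>j. (\<Sum>k<K. ((1 - p) ^ Suc j) ^ Suc k / Suc k)) sums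
      (\<Sum>k<K. (1 - p) ^ Suc k / (1 - (1 - p) ^ Suc k) / Suc k)"
  proof (intro sums_sum sums_divide)
    fix k
    have "0 \<le> (1 - p) ^ Suc k" "(1 - p) ^ Suc k < 1"
      using assms by (auto simp: power_less_one_iff simp del: power_Suc)
    then have "(\<lambda>j. (1 - p) ^ Suc k * ((1 - p) ^ Suc k) ^ j) sums ((1 - p) ^ Suc k * (1 / (1 - (1 - p) ^ Suc k)))"
      by (intro sums_mult geometric_sums) simp
    moreover have "(1 - p) ^ Suc k * ((1 - p) ^ Suc k) ^ j = ((1 - p) ^ Suc j) ^ Suc k" for j
      by (rule power_Suc_swap[symmetric])
    ultimately show "(\<lambda>j. ((1 - p) ^ Suc j) ^ Suc k) sums ((1 - p) ^ Suc k / (1 - (1 - p) ^ Suc k))"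
      by (simp only: times_divide_eq_right mult_1_right)
  qed
  have "(\<Sum>k<K. 1 / (real k + 1)\<^sup>2) / p - K \<le> (\<Sum>k<K. (1 / (p * Suc k) - 1) / Suc k)"
  proof -
    have "(\<Sum>k<K. 1 / (real k + 1)\<^sup>2) / p - K = (\<Sum>k<K. 1 / (real k + 1)\<^sup>2 / p - 1)"
      by (simp add: sum_subtractf sum_divide_distrib)
    also have "\<dots> \<le> (\<Sum>k<K. (1 / (p * Suc k) - 1) / Suc k)"
    proof (rule sum_mono)
      fix k
      have eq: "1 / (real k + 1)\<^sup>2 / p = 1 / (p * Suc k) / Suc k" by (simp add: power2_eq_square field_simps)
      have "1 / real (Suc k) \<le> 1" by simp
      then show "1 / (real k + 1)\<^sup>2 / p - 1 \<le> (1 / (p * Suc k) - 1) / Suc k"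
        unfolding eq diff_divide_distrib by linarith
    qed
    finally show ?thesis .
  qed
  also have "\<dots> \<le> (\<Sum>k<K. (1 - p) ^ Suc k / (1 - (1 - p) ^ Suc k) / Suc k)"
    using geometric_ratio_lower[OF assms] by (intro sum_mono divide_right_mono) auto
  also have "\<dots> \<le> total_cost p"
    unfolding total_cost_def
  proof (rule sums_le[OF _ geo summable_sums[OF summable_cost[OF assms]]])
    fix j
    have s: "(\<lambda>k. ((1 - p) ^ Suc j) ^ Suc k / real (Suc k)) sums cost p (Suc j)"
      by (rule cost_series) (use assms in auto)
    have "(\<Sum>k<K. ((1 - p) ^ Suc j) ^ Suc k / real (Suc k)) \<le> (\<Sum>k. ((1 - p) ^ Suc j) ^ Suc k / real (Suc k))"
      by (rule sum_le_suminf) (use assms s[THEN sums_summable] in auto)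
    then show "(\<Sum>k<K. ((1 - p) ^ Suc j) ^ Suc k / real (Suc k)) \<le> cost p (Suc j)"
      using s by (simp add: sums_iff)
  qed
  finally have "(\<Sum>k<K. 1 / (real k + 1)\<^sup>2) / p - K \<le> total_cost p" .
  moreover have "(pi\<^sup>2 / 6 - 1 / K) / p \<le> (\<Sum>k<K. 1 / (real k + 1)\<^sup>2) / p"
    using partial_basel[OF K(3)] assms by (intro divide_right_mono) auto
  moreover have "1 / K / p \<le> 1 / sqrt p"
  proof -
    have "1 / K \<le> sqrt p" using K assms by (simp add: field_simps)
    then have "1 / K / p \<le> sqrt p / p" using assms by (intro divide_right_mono) auto
    also have "\<dots> = 1 / sqrt p" using assms by (metis less_imp_le real_div_sqrt inverse_divide inverse_eq_divide)
    finally show ?thesis .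
  qed
  ultimately show ?thesis using K(2) by (simp add: diff_divide_distrib)
qed

lemma total_cost_tail:
  assumes "0 < p" "p < 1" "0 < y"
  shows "total_cost p \<le> (\<Sum>j<y. cost p (Suc j)) + cost p y / p"
proof -
  have "total_cost p = (\<Sum>i. cost p (Suc (i + y))) + (\<Sum>j<y. cost p (Suc j))"
    unfolding total_cost_def by (rule suminf_split_initial_segment[OF summable_cost[OF assms(1,2)]])
  moreover have "(\<Sum>i. cost p (Suc (i + y))) \<le> cost p y / p"
  proof (rule sums_le)
    show "(\<lambda>i. cost p (Suc (i + y))) sums (\<Sum>i. cost p (Suc (i + y)))"
      using summable_ignore_initial_segment[OF summable_cost[OF assms(1,2)], of y] by (simp add: summable_sums)
    show "(\<lambda>i. (1 - p) ^ i * cost p y) sums (cost p y / p)"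
      using sums_mult2[OF geometric_sums[of "1 - p"], of "cost p y"] assms by simp
    fix i
    have "cost p (Suc (i + y)) \<le> cost p (y + i)" using assms by (intro cost_antimono) auto
    also have "\<dots> \<le> (1 - p) ^ i * cost p y" by (rule cost_decay[OF assms])
    finally show "cost p (Suc (i + y)) \<le> (1 - p) ^ i * cost p y" .
  qed
  ultimately show ?thesis by simp
qed

section \<open>A potential that bounds the cost of every growth path\<close>

text \<open>Up to a shift by one in the line lengths, the cost of growing diagonally to a square on
  the shorter side and then straight ahead, which convexity makes the cheapest path.\<close>

definition potential :: "real \<Rightarrow> nat \<Rightarrow> nat \<Rightarrow> real" where
  "potential p m n = 2 * (\<Sum>j<min m n. cost p (Suc j)) + cost p (min m n) * (real (max m n) - real (min m n))"

lemma potential_commute: "potential p m n = potential p n m"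
  unfolding potential_def by (simp add: min.commute max.commute)

text \<open>Lengthening the longer side gives equality. Lengthening the shorter side also cheapens
  the straight part of the path, and the secant inequality bounds the net change by the cost of a
  line as long as the longer side.\<close>

lemma potential_Suc:
  assumes "0 < p" "p < 1" "0 < m" "0 < n"
  shows "potential p (Suc m) n \<le> potential p m n + cost p n"
proof (cases "n \<le> m")
  case True
  then show ?thesis by (simp add: potential_def min_def max_def algebra_simps)
next
  case False
  then obtain d where d: "n = Suc m + d" using less_imp_Suc_add[of m n] by auto
  have "cost p (Suc m) + real d * (cost p (Suc m) - cost p m) \<le> cost p n"
    using cost_above_secant[OF assms(1-3), of "Suc d"] d by (simp add: algebra_simps)
  moreover have "cost p (Suc m) \<le> cost p m" using assms by (intro cost_antimono) auto
  ultimately show ?thesis using d by (simp add: potential_def min_def max_def algebra_simps)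
qed

text \<open>All new lines are charged at the old side lengths, to match
  \<open>prob_lines_filled\<close>. This can only overestimate the cost, so the inequality
  survives.\<close>

lemma potential_add:
  assumes "0 < p" "p < 1" "0 < m" "0 < n"
  shows "potential p (m + s) (n + t) \<le> potential p m n + s * cost p n + t * cost p m"
proof -
  have add1: "potential p (m + s) n \<le> potential p m n + s * cost p n" if "0 < m" "0 < n" for m n s
  proof (induction s)
    case (Suc s)
    then show ?case using potential_Suc[OF assms(1,2), of "m + s" n] that by (simp add: algebra_simps)
  qed simp
  have "potential p (m + s) (n + t) \<le> potential p (m + s) n + t * cost p (m + s)"
    using add1[of n "m + s" t] assms by (simp add: potential_commute)
  also have "t * cost p (m + s) \<le> t * cost p m"
    using cost_antimono[of p m "m + s"] assms by (intro mult_left_mono) auto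
  finally show ?thesis using add1[OF assms(3,4), of s] by simp
qed

text \<open>Past the cutoff almost nothing is left to pay. For an elongated rectangle the straight
  part of the potential covers the tails of both sums of costs; otherwise the shorter side is long
  enough for each tail to be at most 1.\<close>

lemma potential_ge_total_cost:
  assumes p: "0 < p" "p \<le> 1/2" and mn: "0 < m" "0 < n"
    and big: "8 * ln (1 / p) \<le> p * real (max m n)"
  shows "2 * total_cost p - 2 \<le> potential p m n"
proof -
  define x y where "x = max m n" and "y = min m n"
  have y: "0 < y" using mn by (simp add: y_def)
  have p1: "p < 1" using p by simp
  have c: "0 \<le> cost p y" using cost_nonneg p y by simp
  have tail: "2 * total_cost p \<le> 2 * (\<Sum>j<y. cost p (Suc j)) + 2 * (cost p y / p)"
    using total_cost_tail[OF p(1) p1 y] by simp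
  have pot: "potential p m n = 2 * (\<Sum>j<y. cost p (Suc j)) + cost p y * (real x - real y)"
    by (simp add: potential_def x_def y_def)
  show ?thesis
  proof (cases "2 / p \<le> real x - real y")
    case True
    then have "cost p y * (2 / p) \<le> cost p y * (real x - real y)" using c by (rule mult_left_mono)
    moreover have "cost p y * (2 / p) = 2 * (cost p y / p)" by simp
    ultimately show ?thesis using tail pot by linarith
  next
    case False
    then have "p * real x < 2 + p * real y" using p by (simp add: field_simps)
    then have py: "8 * ln (1 / p) - 2 \<le> p * real y" using big by (simp add: x_def)
    have "(1 - p) ^ y \<le> exp (- p) ^ y"
      using exp_ge_add_one_self[of "- p"] p by (intro power_mono) auto
    also have "\<dots> = exp (- (p * real y))" by (simp add: exp_of_nat_mult[symmetric] mult.commute)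
    also have "\<dots> \<le> exp (2 - 8 * ln (1 / p))" using py by simp
    also have "\<dots> = exp 1 ^ 2 * p ^ 8"
    proof -
      have e: "2 - 8 * ln (1 / p) = of_nat 2 * 1 + of_nat 8 * ln p" using p by (simp add: ln_div)
      show ?thesis unfolding e exp_add exp_of_nat_mult using p by simp
    qed
    also have "\<dots> \<le> 3 ^ 2 * ((1/2) ^ 7 * p)"
    proof -
      have "p ^ 8 = p ^ 7 * p" by (simp add: power_Suc2[symmetric] eval_nat_numeral)
      also have "\<dots> \<le> (1/2) ^ 7 * p" using p by (intro mult_right_mono power_mono) auto
      finally show ?thesis using exp_le p by (intro mult_mono power_mono) auto
    qed
    also have "\<dots> \<le> p / 2" using p by (simp add: field_simps)
    finally have r: "(1 - p) ^ y \<le> p / 2" .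
    have "cost p y \<le> (1 - p) ^ y / (1 - (1 - p) ^ y)" by (rule cost_le_ratio[OF p(1) p1 y])
    also have "\<dots> \<le> (p / 2) / (1 / 2)" using r p by (intro frac_le) auto
    finally have "cost p y / p \<le> 1" using p by simp
    moreover have "0 \<le> cost p y * (real x - real y)" using c by (simp add: x_def y_def)
    ultimately show ?thesis using tail pot by simp
  qed
qed

text \<open>Obtained from \<open>(1-p)^n (1+p)^n <= 1\<close>. The rational form is chosen to match
  the denominator of \<open>speed\<close>.\<close>

lemma fill_prob_ge:
  assumes "0 < p" "p < 1"
  shows "p * n / (1 + p * n) \<le> fill_prob p n"
proof -
  have "(1 - p) ^ n * (1 + p * n) \<le> (1 - p) ^ n * (1 + p) ^ n"
    using Bernoulli_inequality[of p n] assms by (intro mult_left_mono) (auto simp: mult.commute)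
  also have "\<dots> = (1 - p\<^sup>2) ^ n"
    by (simp add: power_mult_distrib[symmetric] algebra_simps power2_eq_square)
  also have "\<dots> \<le> 1" using assms by (intro power_le_one) (auto simp: power_le_one)
  finally have "(1 - p) ^ n * (1 + p * n) \<le> 1" .
  moreover have "0 < 1 + p * n" using assms by (simp add: add_pos_nonneg)
  ultimately show ?thesis by (simp add: fill_prob_def field_simps)
qed

subsection \<open>Rectangles with a filled site on the rim\<close>

definition rect :: "int \<Rightarrow> int \<Rightarrow> nat \<Rightarrow> nat \<Rightarrow> site set" where
  "rect a c m n = {a..<a + int m} \<times> {c..<c + int n}"

definition rim :: "int \<Rightarrow> int \<Rightarrow> nat \<Rightarrow> nat \<Rightarrow> site set" where
  "rim a c m n = rect (a - 1) (c - 1) (m + 2) (n + 2) - rect a c m n"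

lemma finite_rect [simp]: "finite (rect a c m n)"
  by (simp add: rect_def)

lemma finite_rim [simp]: "finite (rim a c m n)"
  by (simp add: rim_def)

lemma evolve_Suc: "evolve m (Suc t) \<sigma> = step m (evolve m t \<sigma>)"
  by (simp add: evolve_def)

lemma evolve_0 [simp]: "evolve m 0 \<sigma> = \<sigma>"
  by (simp add: evolve_def)

lemma evolve_inactive: "evolve m t \<sigma> x \<noteq> Active \<Longrightarrow> evolve m t \<sigma> x = \<sigma> x"
proof (induction t)
  case (Suc t)
  then show ?case
    unfolding evolve_Suc step_def by (auto split: state.splits if_splits)
qed simp

lemma linfdist_le_l1dist: "linfdist x y \<le> l1dist x y"
  unfolding linfdist_def l1dist_def by auto

lemma occ_dist_between: "linfdist x y \<le> occ_dist m x y" "occ_dist m x y \<le> l1dist x y"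
  using linfdist_le_l1dist by (cases m; auto simp: occ_dist_def)+

text \<open>This is why rectangles are barriers: an empty site outside needs two active neighbours,
  but only one of its neighbours can lie inside.\<close>

lemma rect_neighbour_unique:
  assumes "x \<notin> rect a c m n" "y \<in> rect a c m n" "z \<in> rect a c m n" "l1dist y x \<le> 1" "l1dist z x \<le> 1"
  shows "y = z"
  using assms unfolding rect_def l1dist_def by (cases x; cases y; cases z) auto

lemma rect_near_rim: "x \<notin> rect a c m n \<Longrightarrow> y \<in> rect a c m n \<Longrightarrow> linfdist y x \<le> 1 \<Longrightarrow> x \<in> rim a c m n"
  unfolding rect_def linfdist_def rim_def by (cases x; cases y) auto

lemma active_confined:
  assumes act: "\<And>x. \<sigma> x = Active \<Longrightarrow> x \<in> rect a c m n" and rim: "\<sigma> \<notin> some_filled (rim a c m n)"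
  shows "evolve md t \<sigma> x = Active \<Longrightarrow> x \<in> rect a c m n"
proof (induction t arbitrary: x)
  case 0
  then show ?case using act by simp
next
  case (Suc t)
  let ?\<tau> = "evolve md t \<sigma>"
  show ?case
  proof (rule ccontr)
    assume out: "x \<notin> rect a c m n"
    then have na: "?\<tau> x \<noteq> Active" using Suc.IH by blast
    have old: "?\<tau> x = \<sigma> x" by (rule evolve_inactive[OF na])
    show False
    proof (cases "?\<tau> x")
      case Empty
      then have "2 \<le> card {y. l1dist y x \<le> 1 \<and> ?\<tau> y = Active}"
        using Suc.prems by (auto simp: evolve_Suc step_def split: if_splits)
      moreover from this have "finite {y. l1dist y x \<le> 1 \<and> ?\<tau> y = Active}"
        by (intro card_ge_0_finite) simp
      ultimately obtain y z where "y \<noteq> z" "l1dist y x \<le> 1" "l1dist z x \<le> 1" "?\<tau> y = Active" "?\<tau> z = Active"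
        using card_le_Suc0_iff_eq[of "{y. l1dist y x \<le> 1 \<and> ?\<tau> y = Active}"] by auto
      then show False using rect_neighbour_unique[OF out] Suc.IH by blast
    next
      case Occupied
      then obtain y where y: "occ_dist md y x \<le> 1" "?\<tau> y = Active"
        using Suc.prems by (auto simp: evolve_Suc step_def split: if_splits)
      then have "x \<in> rim a c m n"
        using rect_near_rim[OF out Suc.IH[OF y(2)]] occ_dist_between(1)[of y x md] by linarith
      then show False using rim Occupied old by (auto simp: some_filled_def)
    next
      case Active
      then show False using na by simp
    qed
  qed
qed

text \<open>Quantifying over all larger rectangles at once makes the event depend only on sites
  outside the first one and pass on to every extension. These two properties drive the
  recursion.\<close>

definition never_stuck :: "int \<Rightarrow> int \<Rightarrow> nat \<Rightarrow> nat \<Rightarrow> config set" where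
  "never_stuck a c m n =
     (\<Inter>(l, r, d, u)\<in>UNIV. some_filled (rim (a - int l) (c - int d) (m + l + r) (n + d + u)))"

lemma never_stuck_measurable: "never_stuck a c m n \<in> sets (init_law p)"
  unfolding never_stuck_def
  by (intro sets.countable_INT') (auto simp: some_filled_measurable split: prod.splits)

lemma depends_never_stuck: "depends_on (never_stuck a c m n) (- rect a c m n)"
proof (rule depends_on_mono)
  show "depends_on (never_stuck a c m n)
      (\<Union>z\<in>UNIV. case z of (l, r, d, u) \<Rightarrow> rim (a - int l) (c - int d) (m + l + r) (n + d + u))"
    unfolding never_stuck_def
    by (intro depends_on_INT) (auto simp: depends_some_filled split: prod.splits)
  show "(\<Union>z\<in>UNIV. case z of (l, r, d, u) \<Rightarrow> rim (a - int l) (c - int d) (m + l + r) (n + d + u))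
      \<subseteq> - rect a c m n"
    by (auto simp: rim_def rect_def)
qed

lemma never_stuck_extension:
  "never_stuck a c m n \<subseteq> never_stuck (a - int l) (c - int d) (m + l + r) (n + d + u)"
proof
  fix \<sigma> assume "\<sigma> \<in> never_stuck a c m n"
  then have *: "\<sigma> \<in> some_filled (rim (a - int l) (c - int d) (m + l + r) (n + d + u))" for l r d u
    by (auto simp: never_stuck_def)
  show "\<sigma> \<in> never_stuck (a - int l) (c - int d) (m + l + r) (n + d + u)"
    unfolding never_stuck_def
  proof (intro INT_I, clarify)
    fix l' r' d' u'
    show "\<sigma> \<in> some_filled (rim (a - int l - int l') (c - int d - int d') (m + l + r + l' + r') (n + d + u + d' + u'))"
      using *[of "l + l'" "d + d'" "r + r'" "u + u'"] by (simp add: algebra_simps)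
  qed
qed

text \<open>An empty rim would confine all activity, so the site just to the left of that rectangle
  would never become active.\<close>

lemma growth_never_stuck:
  assumes "\<And>x. \<sigma> x = Active \<Longrightarrow> x = (0, 0)" "indefinite_growth md \<sigma>" "0 < m" "0 < n"
  shows "\<sigma> \<in> never_stuck 0 0 m n"
proof (rule ccontr)
  assume "\<sigma> \<notin> never_stuck 0 0 m n"
  then obtain l r d u where stuck: "\<sigma> \<notin> some_filled (rim (- int l) (- int d) (m + l + r) (n + d + u))"
    by (auto simp: never_stuck_def)
  have "(- int l - 1, 0) \<in> rect (- int l) (- int d) (m + l + r) (n + d + u)"
  proof -
    obtain t where "evolve md t \<sigma> (- int l - 1, 0) = Active"
      using assms(2) unfolding indefinite_growth_def by blast
    moreover have "x \<in> rect (- int l) (- int d) (m + l + r) (n + d + u)" if "\<sigma> x = Active" for x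
      using assms(1)[OF that] assms(3,4) by (simp add: rect_def)
    ultimately show ?thesis using active_confined[OF _ stuck] by blast
  qed
  then show False by (simp add: rect_def)
qed

section \<open>Extensions of a rectangle with all new lines filled\<close>

text \<open>New lines have their full length in the enlarged rectangle, so a corner site may serve a
  row and a column at once. This is all that a filled rim site guarantees, and the price is that the
  lines are dependent.\<close>

definition lines_filled :: "int \<Rightarrow> int \<Rightarrow> nat \<Rightarrow> nat \<Rightarrow> nat \<Rightarrow> nat \<Rightarrow> nat \<Rightarrow> nat \<Rightarrow> config set" where
  "lines_filled a c m n l r d u =
    (\<Inter>x\<in>{a - int l..<a + int m + int r} - {a..<a + int m}. some_filled ({x} \<times> {c - int d..<c + int n + int u})) \<inter>
    (\<Inter>y\<in>{c - int d..<c + int n + int u} - {c..<c + int n}. some_filled ({a - int l..<a + int m + int r} \<times> {y}))"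

lemma depends_lines_filled:
  "depends_on (lines_filled a c m n l r d u)
     (rect (a - int l) (c - int d) (m + l + r) (n + d + u) - rect a c m n)"
  unfolding lines_filled_def
  by (rule depends_on_mono[OF depends_on_Int[OF depends_Inter_some_filled depends_Inter_some_filled]])
     (auto simp: rect_def)

lemma lines_filled_measurable: "lines_filled a c m n l r d u \<in> sets (init_law p)"
  by (rule depends_on_finite_measurable[OF _ depends_lines_filled]) simp

text \<open>A filled rim site lies on one new line or, at a corner, on a new row and a new column;
  every line it meets is added. The lines added earlier only become longer and so stay
  filled.\<close>

lemma lines_filled_extend:
  assumes \<sigma>: "\<sigma> \<in> lines_filled a c m n l r d u"
    and xy: "(x, y) \<in> rim (a - int l) (c - int d) (m + l + r) (n + d + u)" "\<sigma> (x, y) \<noteq> Empty"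
  obtains i j k h where "i + j \<le> 1" "k + h \<le> 1" "0 < i + j + k + h"
    "\<sigma> \<in> lines_filled a c m n (l + i) (r + j) (d + k) (u + h)"
proof -
  define i where "i = (if x = a - int l - 1 then 1 else 0 :: nat)"
  define j where "j = (if x = a + int m + int r then 1 else 0 :: nat)"
  define k where "k = (if y = c - int d - 1 then 1 else 0 :: nat)"
  define h where "h = (if y = c + int n + int u then 1 else 0 :: nat)"
  have x: "a - int l - int i \<le> x" "x < a + int m + int r + int j"
    and y: "c - int d - int k \<le> y" "y < c + int n + int u + int h"
    using xy(1) by (auto simp: rim_def rect_def i_def j_def k_def h_def)
  have pos: "0 < i + j + k + h"
    using xy(1) by (auto simp: rim_def rect_def i_def j_def k_def h_def)
  have 1: "i + j \<le> 1" "k + h \<le> 1" by (auto simp: i_def j_def k_def h_def)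
  have "\<sigma> \<in> lines_filled a c m n (l + i) (r + j) (d + k) (u + h)"
    unfolding lines_filled_def
  proof (intro IntI INT_I)
    fix x' assume x': "x' \<in> {a - int (l + i)..<a + int m + int (r + j)} - {a..<a + int m}"
    show "\<sigma> \<in> some_filled ({x'} \<times> {c - int (d + k)..<c + int n + int (u + h)})"
    proof (cases "x' = x")
      case True
      then show ?thesis using xy(2) y by (auto simp: some_filled_def)
    next
      case False
      then have "x' \<in> {a - int l..<a + int m + int r} - {a..<a + int m}"
        using x' by (auto simp: i_def j_def split: if_splits)
      then have "\<sigma> \<in> some_filled ({x'} \<times> {c - int d..<c + int n + int u})"
        using \<sigma> by (auto simp: lines_filled_def)
      then show ?thesis by (auto simp: some_filled_def)
    qed
  next
    fix y' assume y': "y' \<in> {c - int (d + k)..<c + int n + int (u + h)} - {c..<c + int n}"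
    show "\<sigma> \<in> some_filled ({a - int (l + i)..<a + int m + int (r + j)} \<times> {y'})"
    proof (cases "y' = y")
      case True
      then show ?thesis using xy(2) x by (auto simp: some_filled_def)
    next
      case False
      then have "y' \<in> {c - int d..<c + int n + int u} - {c..<c + int n}"
        using y' by (auto simp: k_def h_def split: if_splits)
      then have "\<sigma> \<in> some_filled ({a - int l..<a + int m + int r} \<times> {y'})"
        using \<sigma> by (auto simp: lines_filled_def)
      then show ?thesis by (auto simp: some_filled_def)
    qed
  qed
  with that 1 pos show ?thesis by blast
qed

definition choices :: "nat \<Rightarrow> nat \<Rightarrow> (nat \<times> nat \<times> nat \<times> nat) set" where
  "choices S T = {(l, r, d, u). l + r \<le> S \<and> d + u \<le> T \<and> (l + r = S \<or> d + u = T)}"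

lemma choices_subset: "choices S T \<subseteq> {..S} \<times> {..S} \<times> {..T} \<times> {..T}"
  unfolding choices_def by auto

lemma finite_choices: "finite (choices S T)"
  by (rule finite_subset[OF choices_subset]) simp

lemma card_choices: "card (choices S T) \<le> (S + 1)\<^sup>2 * (T + 1)\<^sup>2"
proof -
  have "card (choices S T) \<le> card ({..S} \<times> {..S} \<times> {..T} \<times> {..T})"
    by (rule card_mono[OF _ choices_subset]) simp
  also have "\<dots> = (S + 1)\<^sup>2 * (T + 1)\<^sup>2"
    unfolding card_cartesian_product card_atMost Suc_eq_plus1 by (simp only: power2_eq_square mult.assoc)
  finally show ?thesis .
qed

text \<open>A maximal rectangle among those reachable within the prescribed increments must exhaust one of
  the two increments, since otherwise a filled site on its rim would enlarge it.\<close>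

lemma never_stuck_subset:
  "never_stuck a c m n \<subseteq> (\<Union>(l, r, d, u)\<in>choices S T. lines_filled a c m n l r d u)"
proof
  fix \<sigma> assume \<sigma>: "\<sigma> \<in> never_stuck a c m n"
  define P where "P = (\<lambda>(l, r, d, u). l + r \<le> S \<and> d + u \<le> T \<and> \<sigma> \<in> lines_filled a c m n l r d u)"
  define f where "f = (\<lambda>(l, r, d, u). l + r + d + u :: nat)"
  have "P (0, 0, 0, 0)" by (simp add: P_def lines_filled_def)
  moreover have "\<forall>z. P z \<longrightarrow> f z < S + T + 1" by (auto simp: P_def f_def)
  ultimately obtain z where z: "P z" "\<And>z'. P z' \<Longrightarrow> f z' \<le> f z"
    using ex_has_greatest_nat[of P _ f] by blast
  obtain l r d u where zz: "z = (l, r, d, u)" by (cases z) auto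
  from z(1) have le: "l + r \<le> S" "d + u \<le> T" and \<sigma>': "\<sigma> \<in> lines_filled a c m n l r d u"
    by (auto simp: P_def zz)
  have "l + r = S \<or> d + u = T"
  proof (rule ccontr)
    assume "\<not> (l + r = S \<or> d + u = T)"
    then have less: "l + r < S" "d + u < T" using le by auto
    from \<sigma> have "\<sigma> \<in> some_filled (rim (a - int l) (c - int d) (m + l + r) (n + d + u))"
      by (auto simp: never_stuck_def)
    then obtain x y where "(x, y) \<in> rim (a - int l) (c - int d) (m + l + r) (n + d + u)" "\<sigma> (x, y) \<noteq> Empty"
      by (auto simp: some_filled_def)
    from lines_filled_extend[OF \<sigma>' this] obtain i j k h where
      e: "i + j \<le> 1" "k + h \<le> 1" "0 < i + j + k + h"
        "\<sigma> \<in> lines_filled a c m n (l + i) (r + j) (d + k) (u + h)" .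
    then have "P (l + i, r + j, d + k, u + h)" using less by (simp add: P_def)
    from z(2)[OF this] e(3) show False by (simp add: f_def zz)
  qed
  then show "\<sigma> \<in> (\<Union>(l, r, d, u)\<in>choices S T. lines_filled a c m n l r d u)"
    using le \<sigma>' by (auto simp: choices_def intro!: bexI[of _ z] simp: zz)
qed

lemma sum_Pow_power_card:
  fixes x :: real
  assumes "finite A"
  shows "(\<Sum>T\<in>Pow A. x ^ card T) = (1 + x) ^ card A"
  using prod_add[OF assms, of "\<lambda>_. x" "\<lambda>_. 1"] by (simp add: add.commute)

text \<open>A union bound over the set \<open>T\<close> of filled corner sites. Each of them costs
  \<open>p\<close> and relieves at most one column and one row of the need for a filled site
  alongside the old rectangle; summing \<open>(p / (f g))^|T|\<close> over all \<open>T\<close>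
  gives the last factor.\<close>

lemma prob_lines_filled:
  fixes l r d u :: nat
  assumes p: "0 < p" "p < 1" and mn: "0 < m" "0 < n"
  defines "s \<equiv> l + r" and "t \<equiv> d + u"
  shows "measure (init_law p) (lines_filled a c m n l r d u) \<le>
    fill_prob p n ^ s * fill_prob p m ^ t * (1 + p / (fill_prob p n * fill_prob p m)) ^ (s * t)"
proof -
  interpret prob_space "init_law p" by (rule prob_space_init_law)
  define C D where "C = {a - int l..<a + int m + int r} - {a..<a + int m}"
    and "D = {c - int d..<c + int n + int u} - {c..<c + int n}"
  define col row where "col = (\<lambda>x::int. {x} \<times> {c..<c + int n})" and "row = (\<lambda>y::int. {a..<a + int m} \<times> {y})"
  have fin: "finite C" "finite D" by (auto simp: C_def D_def)
  have cC: "card C = s" unfolding C_def s_def by (subst card_Diff_subset) auto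
  have cD: "card D = t" unfolding D_def t_def by (subst card_Diff_subset) auto
  have lines: "finite (col x)" "card (col x) = n" "disjoint_family_on col X"
    "finite (row x)" "card (row x) = m" "disjoint_family_on row X" for x X
    by (auto simp: col_def row_def disjoint_family_on_def card_cartesian_product)
  \<comment> \<open>The corner sites of \<open>T\<close> must be filled, but others may be too. The
    events for different \<open>T\<close> thus overlap, as a union bound permits, while each one is
    an intersection of events on disjoint sets of sites.\<close>
  define Ev where "Ev = (\<lambda>T::site set. (\<Inter>z\<in>T. some_filled {z}) \<inter>
     ((\<Inter>x\<in>C - fst ` T. some_filled (col x)) \<inter> (\<Inter>y\<in>D - snd ` T. some_filled (row y))))"
  let ?f = "fill_prob p n" and ?g = "fill_prob p m"
  have fg: "0 < ?f" "0 < ?g" "?f \<le> 1" "?g \<le> 1"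
    using p mn by (auto simp: fill_prob_pos fill_prob_le_1)
  have sub: "lines_filled a c m n l r d u \<subseteq> (\<Union>T\<in>Pow (C \<times> D). Ev T)"
  proof
    fix \<sigma> assume \<sigma>: "\<sigma> \<in> lines_filled a c m n l r d u"
    let ?T = "{z \<in> C \<times> D. \<sigma> z \<noteq> Empty}"
    have "\<sigma> \<in> some_filled (col x)" if x: "x \<in> C - fst ` ?T" for x
    proof -
      obtain y where "y \<in> {c - int d..<c + int n + int u}" "\<sigma> (x, y) \<noteq> Empty"
        using \<sigma> x unfolding lines_filled_def C_def[symmetric] by (auto simp: some_filled_def)
      moreover have "y \<notin> D" using x calculation by force
      ultimately show ?thesis by (auto simp: D_def some_filled_def col_def)
    qed
    moreover have "\<sigma> \<in> some_filled (row y)" if y: "y \<in> D - snd ` ?T" for y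
    proof -
      obtain x where "x \<in> {a - int l..<a + int m + int r}" "\<sigma> (x, y) \<noteq> Empty"
        using \<sigma> y unfolding lines_filled_def D_def[symmetric] by (auto simp: some_filled_def)
      moreover have "x \<notin> C" using y calculation by force
      ultimately show ?thesis by (auto simp: C_def some_filled_def row_def)
    qed
    ultimately have "\<sigma> \<in> Ev ?T" by (auto simp: Ev_def some_filled_def)
    then show "\<sigma> \<in> (\<Union>T\<in>Pow (C \<times> D). Ev T)" by auto
  qed
  have prob_Ev: "Ev T \<in> sets (init_law p) \<and>
      prob (Ev T) \<le> ?f ^ s * ?g ^ t * (p / (?f * ?g)) ^ card T" if T: "T \<subseteq> C \<times> D" for T
  proof -
    have finT: "finite T" using T fin finite_subset by blast
    let ?A = "\<Inter>z\<in>T. some_filled {z}" and ?B = "\<Inter>x\<in>C - fst ` T. some_filled (col x)"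
      and ?B' = "\<Inter>y\<in>D - snd ` T. some_filled (row y)"
    let ?IB = "\<Union>x\<in>C - fst ` T. col x" and ?IB' = "\<Union>y\<in>D - snd ` T. row y"
    have dA: "depends_on ?A T" using depends_Inter_some_filled[where S="\<lambda>z. {z}" and A=T] by simp
    have dB: "depends_on ?B ?IB" and dB': "depends_on ?B' ?IB'"
      by (rule depends_Inter_some_filled)+
    have finI: "finite ?IB" "finite ?IB'" using fin by (auto simp: col_def row_def)
    have mA: "?A \<in> events" and mB: "?B \<in> events" and mB': "?B' \<in> events"
      using depends_on_finite_measurable dA dB dB' finT finI by blast+
    have dBB: "depends_on (?B \<inter> ?B') (?IB \<union> ?IB')" by (rule depends_on_Int[OF dB dB'])
    have "T \<inter> (?IB \<union> ?IB') = {}"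
      using T by (auto simp: col_def row_def C_def D_def)
    then have "prob (Ev T) = prob ?A * prob (?B \<inter> ?B')"
      unfolding Ev_def by (intro indep_depends_on[OF mA dA _ dBB]) (use mB mB' in auto)
    also have "prob (?B \<inter> ?B') = prob ?B * prob ?B'"
      by (intro indep_depends_on[OF mB dB mB' dB']) (auto simp: col_def row_def C_def D_def)
    also have "prob ?A = p ^ card T"
      using prob_Inter_some_filled[of p T "\<lambda>z. {z}"] p finT by (simp add: disjoint_family_on_def)
    also have "prob ?B = ?f ^ card (C - fst ` T)"
      using prob_Inter_some_filled[of p "C - fst ` T" col] p fin lines by simp
    also have "prob ?B' = ?g ^ card (D - snd ` T)"
      using prob_Inter_some_filled[of p "D - snd ` T" row] p fin lines by simp
    also have "p ^ card T * (?f ^ card (C - fst ` T) * ?g ^ card (D - snd ` T))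
        \<le> p ^ card T * ((?f ^ s / ?f ^ card T) * (?g ^ t / ?g ^ card T))"
    proof (intro mult_left_mono mult_mono)
      have "card (fst ` T) \<le> card T" "card (snd ` T) \<le> card T" using finT by (auto intro: card_image_le)
      moreover have "card C - card (fst ` T) \<le> card (C - fst ` T)" "card D - card (snd ` T) \<le> card (D - snd ` T)"
        using finT by (auto intro: diff_card_le_card_Diff)
      ultimately have le: "s \<le> card (C - fst ` T) + card T" "t \<le> card (D - snd ` T) + card T"
        using cC cD by auto
      show "?f ^ card (C - fst ` T) \<le> ?f ^ s / ?f ^ card T"
        using power_decreasing[OF le(1), of ?f] fg by (simp add: power_add pos_le_divide_eq)
      show "?g ^ card (D - snd ` T) \<le> ?g ^ t / ?g ^ card T"
        using power_decreasing[OF le(2), of ?g] fg by (simp add: power_add pos_le_divide_eq)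
    qed (use p fg in auto)
    also have "\<dots> = ?f ^ s * ?g ^ t * (p / (?f * ?g)) ^ card T"
      by (simp add: power_divide power_mult_distrib)
    finally have "prob (Ev T) \<le> ?f ^ s * ?g ^ t * (p / (?f * ?g)) ^ card T" .
    moreover have "Ev T \<in> events" unfolding Ev_def using mA mB mB' by auto
    ultimately show ?thesis by simp
  qed
  have "prob (lines_filled a c m n l r d u) \<le> prob (\<Union>T\<in>Pow (C \<times> D). Ev T)"
    using fin prob_Ev by (intro finite_measure_mono sub sets.finite_UN) auto
  also have "\<dots> \<le> (\<Sum>T\<in>Pow (C \<times> D). prob (Ev T))"
    using fin prob_Ev by (intro finite_measure_subadditive_finite) auto
  also have "\<dots> \<le> (\<Sum>T\<in>Pow (C \<times> D). ?f ^ s * ?g ^ t * (p / (?f * ?g)) ^ card T)"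
    using prob_Ev by (intro sum_mono) auto
  also have "\<dots> = ?f ^ s * ?g ^ t * (1 + p / (?f * ?g)) ^ (s * t)"
    using sum_Pow_power_card[of "C \<times> D" "p / (?f * ?g)"] fin
    by (simp add: sum_distrib_left[symmetric] card_cartesian_product cC cD)
  finally show ?thesis .
qed

subsection \<open>The upper bound\<close>

text \<open>Chosen so that \<open>p * speed p m * speed p n\<close> is the product of
  \<open>pm/(1+pm)\<close> and \<open>pn/(1+pn)\<close>, the lower bounds for the two fill
  probabilities. It is of order \<open>sqrt p * x\<close> up to \<open>x = 1/p\<close> and levels
  off at \<open>1 / sqrt p\<close>.\<close>

definition speed :: "real \<Rightarrow> real \<Rightarrow> real" where
  "speed p x = sqrt p * x / (1 + p * x)"

definition incr :: "real \<Rightarrow> nat \<Rightarrow> nat" where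
  "incr p m = nat \<lceil>speed p (real m)\<rceil>"

lemma pos_of_sqrt_mult: "1 \<le> sqrt p * real m \<Longrightarrow> 0 < m"
  by (cases m) auto

text \<open>The hypothesis on \<open>m\<close> makes \<open>speed\<close> at least 1/2, so rounding
  up costs at most a factor 3 per side, the source of the 9 in \<open>exp 9\<close>. For this reason
  the recursion starts at side length near \<open>p^(-1/2)\<close>.\<close>

lemma incr_bounds:
  assumes p: "0 < p" "p < 1" and m: "1 \<le> sqrt p * real m"
  shows "speed p m \<le> incr p m" "incr p m \<le> 3 * speed p m" "incr p m \<le> m" "incr p m \<le> 3 / sqrt p"
    "1 \<le> incr p m"
proof -
  have m0: "0 < m" using m by (rule pos_of_sqrt_mult)
  have den: "0 < 1 + p * m" using p by (simp add: add_pos_nonneg)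
  have "p * m \<le> sqrt p * m"
    using p by (intro mult_right_mono) (auto simp: sqrt_ge_absD real_le_rsqrt power2_eq_square)
  then have half: "1 / 2 \<le> speed p m"
    unfolding speed_def using m den by (simp add: pos_le_divide_eq)
  then have c: "speed p m \<le> incr p m" "incr p m \<le> speed p m + 1"
    unfolding incr_def by linarith+
  have "sqrt p * real m \<le> 1 * real m" using p by (intro mult_right_mono) auto
  also have "\<dots> \<le> m * (1 + p * m)" using p by (simp add: algebra_simps)
  finally have "speed p m \<le> m" unfolding speed_def using den by (simp add: pos_divide_le_eq)
  then show "incr p m \<le> m" unfolding incr_def by linarith
  show "speed p m \<le> incr p m" by (rule c)
  show 3: "incr p m \<le> 3 * speed p m" using c half by simp
  have "speed p m \<le> sqrt p * m / (p * m)"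
    unfolding speed_def using p m0 den by (intro divide_left_mono mult_pos_pos) auto
  also have "\<dots> = sqrt p / p" using m0 by simp
  also have "\<dots> = 1 / sqrt p" using p by (metis less_imp_le real_div_sqrt inverse_divide inverse_eq_divide)
  finally show "incr p m \<le> 3 / sqrt p" using 3 by simp
  show "1 \<le> incr p m" using half unfolding incr_def by linarith
qed

text \<open>The increments are chosen so that the corners of the extension contain a bounded expected number
  of helpful sites.\<close>

lemma corner_factor:
  assumes p: "0 < p" "p < 1" and m: "1 \<le> sqrt p * real m" and n: "1 \<le> sqrt p * real n"
    and s: "s \<le> incr p m" and t: "t \<le> incr p n"
  shows "(1 + p / (fill_prob p n * fill_prob p m)) ^ (s * t) \<le> exp 9"
proof -
  have mn: "0 < m" "0 < n" using m n by (auto intro: pos_of_sqrt_mult)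
  let ?x = "p / (fill_prob p n * fill_prob p m)"
  have f: "0 < fill_prob p n" "0 < fill_prob p m" using p mn by (auto simp: fill_prob_pos)
  have "real (s * t) \<le> (3 * speed p m) * (3 * speed p n)"
    unfolding of_nat_mult using s t incr_bounds(2)[OF p m] incr_bounds(2)[OF p n]
    by (intro mult_mono) auto
  then have "p * real (s * t) \<le> p * ((3 * speed p m) * (3 * speed p n))"
    using p by (intro mult_left_mono) auto
  also have "\<dots> = 9 * ((p * n / (1 + p * n)) * (p * m / (1 + p * m)))"
  proof -
    have "speed p m * speed p n = (sqrt p * sqrt p) * m * n / ((1 + p * m) * (1 + p * n))"
      unfolding speed_def times_divide_times_eq by (simp only: mult_ac)
    then show ?thesis using p by (simp add: mult_ac)
  qed
  also have "\<dots> \<le> 9 * (fill_prob p n * fill_prob p m)"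
    using fill_prob_ge[OF p] f p by (intro mult_left_mono mult_mono) auto
  finally have "real (s * t) * ?x \<le> 9" using f by (simp add: field_simps)
  moreover have "(1 + ?x) ^ (s * t) \<le> exp (real (s * t) * ?x)"
    unfolding exp_of_nat_mult using f p by (intro power_mono) (auto intro: add_nonneg_nonneg)
  ultimately show ?thesis by (meson exp_le_cancel_iff order_trans)
qed

section \<open>Counting the extensions and paying for their entropy\<close>

definition cutoff :: "real \<Rightarrow> real" where
  "cutoff p = 8 * ln (1 / p) / p"

text \<open>The integral of \<open>1 / speed p\<close> from \<open>x\<close> to
  \<open>2 * cutoff p\<close>, an estimate of how many increments remain. The endpoint is doubled
  because an extension made below the cutoff may double a side.\<close>

definition step_budget :: "real \<Rightarrow> real \<Rightarrow> real" where
  "step_budget p x = (ln (2 * cutoff p) + 2 * (p * cutoff p) - ln x - p * x) / sqrt p"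

lemma step_budget_antimono:
  assumes "0 < p" "0 < x" "x \<le> y"
  shows "step_budget p y \<le> step_budget p x"
proof -
  have "ln x \<le> ln y" using assms by (intro ln_mono) auto
  moreover have "p * x \<le> p * y" using assms by simp
  ultimately have "ln (2 * cutoff p) + 2 * (p * cutoff p) - ln y - p * y
      \<le> ln (2 * cutoff p) + 2 * (p * cutoff p) - ln x - p * x" by linarith
  then show ?thesis
    unfolding step_budget_def using assms(1) by (intro divide_right_mono) auto
qed

text \<open>As \<open>speed p x <= x\<close>, a side at most doubles within one increment, so
  \<open>1 / speed\<close> falls to no less than half of its value and the increment uses up at
  least 1/2 of the integral.\<close>

lemma step_budget_step:
  assumes p: "0 < p" "p < 1" and x: "0 < x" and y: "x + speed p x \<le> y"
  shows "step_budget p y \<le> step_budget p x - 1 / 2"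
proof -
  define w where "w = speed p x"
  have den: "0 < 1 + p * x" using p x by (simp add: add_pos_pos)
  have w: "0 < w" "w * (1 + p * x) = sqrt p * x"
    using p x den by (auto simp: w_def speed_def intro: divide_pos_pos)
  have "sqrt p * x \<le> 1 * x" using p x by (intro mult_right_mono) auto
  also have "\<dots> \<le> x * (1 + p * x)" using p x by (simp add: algebra_simps)
  finally have wx: "w \<le> x" unfolding w_def speed_def using den by (simp add: pos_divide_le_eq)
  have "step_budget p y \<le> step_budget p (x + w)"
    using p x w y by (intro step_budget_antimono) (auto simp: w_def)
  also have "\<dots> = step_budget p x - (ln (x + w) - ln x + p * w) / sqrt p"
    unfolding step_budget_def by (simp add: diff_divide_distrib[symmetric] algebra_simps)
  also have "\<dots> \<le> step_budget p x - 1 / 2"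
  proof -
    have "ln x - ln (x + w) = ln (x / (x + w))" using x w by (simp add: ln_div)
    also have "\<dots> \<le> x / (x + w) - 1" using x w by (intro ln_le_minus_one) auto
    also have "\<dots> = - (w / (x + w))" using x w by (simp add: field_simps)
    also have "\<dots> \<le> - (w / (2 * x))"
      unfolding neg_le_iff_le using x w wx by (intro divide_left_mono) auto
    finally have "w / (2 * x) \<le> ln (x + w) - ln x" by simp
    moreover have "w / (2 * x) + p * w / 2 = sqrt p / 2"
      using w(2) x by (simp add: field_simps)
    moreover have "0 < p * w" using p w by simp
    ultimately have "sqrt p / 2 \<le> ln (x + w) - ln x + p * w" by simp
    then have "1 / 2 \<le> (ln (x + w) - ln x + p * w) / sqrt p" using p by (simp add: pos_le_divide_eq)
    then show ?thesis by simp
  qed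
  finally show ?thesis .
qed

lemma step_budget_nonneg:
  assumes "0 < p" "0 < x" "x \<le> 2 * cutoff p"
  shows "0 \<le> step_budget p x"
proof -
  have "ln x \<le> ln (2 * cutoff p)" using assms by (intro ln_mono) auto
  moreover have "p * x \<le> 2 * (p * cutoff p)" using mult_left_mono[of x "2 * cutoff p" p] assms by simp
  ultimately have "0 \<le> ln (2 * cutoff p) + 2 * (p * cutoff p) - ln x - p * x" by linarith
  then show ?thesis unfolding step_budget_def using assms by simp
qed

text \<open>An extension uses up at least 1/2 of the budget, so the coefficient yields a factor
  \<open>p^2 exp(-17)\<close>. The \<open>p^2\<close> absorbs the power of \<open>1/p\<close> in the
  number of choices; 17 = 9 + 8 pays for the corner factor \<open>exp 9\<close> and for the constant
  256 = 2^8 in that number.\<close>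

definition growth_bound :: "real \<Rightarrow> nat \<Rightarrow> nat \<Rightarrow> real" where
  "growth_bound p m n = exp (potential p m n - (2 * total_cost p - 2) +
     (4 * ln (1 / p) + 34) * (step_budget p m + step_budget p n))"

text \<open>One full increment suffices, since the budget of the other side cannot increase.\<close>

lemma growth_bound_step:
  assumes p: "0 < p" "p < 1" and m: "1 \<le> sqrt p * real m" and n: "1 \<le> sqrt p * real n"
    and st: "incr p m \<le> s \<or> incr p n \<le> t"
  shows "fill_prob p n ^ s * fill_prob p m ^ t * growth_bound p (m + s) (n + t)
    \<le> p ^ 2 * exp (- 17) * growth_bound p m n"
proof -
  have mn: "0 < m" "0 < n" using m n by (auto intro: pos_of_sqrt_mult)
  let ?H = "4 * ln (1 / p) + 34"
  have H: "0 \<le> ?H" using p ln_ge_zero[of "1 / p"] by simp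
  have mono: "step_budget p (m + s) \<le> step_budget p m" "step_budget p (n + t) \<le> step_budget p n"
    using p mn by (auto intro!: step_budget_antimono)
  have "step_budget p (m + s) + step_budget p (n + t) \<le> step_budget p m + step_budget p n - 1 / 2"
    using st
  proof
    assume "incr p m \<le> s"
    then have "step_budget p (m + s) \<le> step_budget p m - 1 / 2"
      using incr_bounds(1)[OF p m] p mn by (intro step_budget_step) auto
    then show ?thesis using mono by simp
  next
    assume "incr p n \<le> t"
    then have "step_budget p (n + t) \<le> step_budget p n - 1 / 2"
      using incr_bounds(1)[OF p n] p mn by (intro step_budget_step) auto
    then show ?thesis using mono by simp
  qed
  then have "?H * (step_budget p (m + s) + step_budget p (n + t)) \<le> ?H * (step_budget p m + step_budget p n - 1 / 2)"
    using H by (rule mult_left_mono)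
  also have "\<dots> = ?H * (step_budget p m + step_budget p n) + 2 * ln p - 17"
    using p by (simp add: ln_div algebra_simps)
  finally have ent: "?H * (step_budget p (m + s) + step_budget p (n + t))
     \<le> ?H * (step_budget p m + step_budget p n) + 2 * ln p - 17" .
  have pot: "potential p (m + s) (n + t) \<le> potential p m n + s * cost p n + t * cost p m"
    by (rule potential_add) (use p mn in auto)
  have f: "fill_prob p n ^ s * fill_prob p m ^ t = exp (- (s * cost p n + t * cost p m))"
  proof -
    have e: "- (s * cost p n + t * cost p m) = of_nat s * (- cost p n) + of_nat t * (- cost p m)" by simp
    show ?thesis
      unfolding e exp_add exp_of_nat_mult using exp_cost[of p n] exp_cost[of p m] p mn by simp
  qed
  have p2: "p ^ 2 * exp (- 17) = exp (2 * ln p - 17)"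
  proof -
    have "2 * ln p - 17 = of_nat 2 * ln p + (- 17)" by simp
    then show ?thesis using p by (simp only: exp_add exp_of_nat_mult exp_ln)
  qed
  show ?thesis
    unfolding growth_bound_def f p2 exp_add[symmetric] exp_le_cancel_iff
    using ent pot by linarith
qed

text \<open>Not being stuck splits into filled lines in a first extension and not being stuck
  afterwards; these events depend on disjoint sets of sites. Once a side reaches the cutoff, the
  claimed bound is at least 1.\<close>

lemma prob_never_stuck:
  assumes p: "0 < p" "p \<le> 1 / 2"
    and m: "1 \<le> sqrt p * real m" "m \<le> 2 * cutoff p" and n: "1 \<le> sqrt p * real n" "n \<le> 2 * cutoff p"
  shows "measure (init_law p) (never_stuck a c m n) \<le> growth_bound p m n"
  using m n
\<comment> \<open>Both sides stay at most \<open>2 * cutoff p\<close>, so \<open>m + n\<close> is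
  capped by \<open>4 * cutoff p\<close> and every extension reduces the distance to the cap.\<close>
proof (induction "nat \<lfloor>4 * cutoff p\<rfloor> - (m + n)" arbitrary: a c m n rule: less_induct)
  case less
  interpret prob_space "init_law p" by (rule prob_space_init_law)
  have p1: "p < 1" using p by simp
  note m = less.prems(1,2) and n = less.prems(3,4)
  have mn: "0 < m" "0 < n" using m n by (auto intro: pos_of_sqrt_mult)
  have H: "0 \<le> 4 * ln (1 / p) + 34" using p ln_ge_zero[of "1 / p"] by simp
  show ?case
  proof (cases "cutoff p \<le> real (max m n)")
    case True
    have "8 * ln (1 / p) = p * cutoff p" using p by (simp add: cutoff_def)
    also have "\<dots> \<le> p * real (max m n)" using True p by (intro mult_left_mono) auto
    finally have "2 * total_cost p - 2 \<le> potential p m n"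
      by (intro potential_ge_total_cost p mn)
    moreover have "0 \<le> (4 * ln (1 / p) + 34) * (step_budget p m + step_budget p n)"
      using step_budget_nonneg[of p m] step_budget_nonneg[of p n] m n mn p H by (intro mult_nonneg_nonneg) auto
    ultimately have "1 \<le> growth_bound p m n" unfolding growth_bound_def by simp
    then show ?thesis using prob_le_1 order_trans by blast
  next
    case False
    define S T where "S = incr p m" and "T = incr p n"
    note Sb = incr_bounds[OF p(1) p1 m(1), folded S_def] and Tb = incr_bounds[OF p(1) p1 n(1), folded T_def]
    define E where "E = (\<lambda>(l, r, d, u). lines_filled a c m n l r d u \<inter>
       never_stuck (a - int l) (c - int d) (m + l + r) (n + d + u))"
    have E_meas: "E z \<in> events" for z
      unfolding E_def by (auto simp: lines_filled_measurable never_stuck_measurable split: prod.splits)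
    have "never_stuck a c m n \<subseteq> (\<Union>z\<in>choices S T. E z)"
    proof
      fix \<sigma> assume \<sigma>: "\<sigma> \<in> never_stuck a c m n"
      then obtain l r d u where "(l, r, d, u) \<in> choices S T" "\<sigma> \<in> lines_filled a c m n l r d u"
        using never_stuck_subset[of a c m n S T] by auto
      moreover have "\<sigma> \<in> never_stuck (a - int l) (c - int d) (m + l + r) (n + d + u)"
        using \<sigma> never_stuck_extension by blast
      ultimately show "\<sigma> \<in> (\<Union>z\<in>choices S T. E z)" by (auto simp: E_def)
    qed
    then have "prob (never_stuck a c m n) \<le> prob (\<Union>z\<in>choices S T. E z)"
      using E_meas finite_choices by (intro finite_measure_mono) auto
    also have "\<dots> \<le> (\<Sum>z\<in>choices S T. prob (E z))"
      using E_meas finite_choices by (intro finite_measure_subadditive_finite) auto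
    also have "\<dots> \<le> (\<Sum>z\<in>choices S T. p ^ 2 * exp (- 8) * growth_bound p m n)"
    proof (rule sum_mono)
      fix z assume z: "z \<in> choices S T"
      obtain l r d u where zz: "z = (l, r, d, u)" by (cases z) auto
      define s t where "s = l + r" and "t = d + u"
      have st: "s \<le> S" "t \<le> T" "s = S \<or> t = T" using z by (auto simp: choices_def zz s_def t_def)
      have grow: "m < m + s \<or> n < n + t" using st Sb(5) Tb(5) by auto
      have ms: "real (m + s) \<le> 2 * cutoff p" "real (n + t) \<le> 2 * cutoff p"
        using st Sb(3) Tb(3) False by auto
      have "prob (E z) = prob (lines_filled a c m n l r d u) *
          prob (never_stuck (a - int l) (c - int d) (m + l + r) (n + d + u))"
        unfolding E_def zz prod.case
        by (rule indep_depends_on[OF lines_filled_measurable depends_lines_filled never_stuck_measurable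
              depends_never_stuck]) auto
      also have "\<dots> \<le> (fill_prob p n ^ s * fill_prob p m ^ t * exp 9) * growth_bound p (m + s) (n + t)"
      proof (rule mult_mono)
        have "prob (lines_filled a c m n l r d u) \<le> fill_prob p n ^ s * fill_prob p m ^ t *
           (1 + p / (fill_prob p n * fill_prob p m)) ^ (s * t)"
          unfolding s_def t_def by (rule prob_lines_filled) (use p mn in auto)
        also have "\<dots> \<le> fill_prob p n ^ s * fill_prob p m ^ t * exp 9"
          using corner_factor[OF p(1) p1 m(1) n(1), of s t] st fill_prob_nonneg[of p] p
          by (intro mult_left_mono) (auto simp: S_def T_def)
        finally show "prob (lines_filled a c m n l r d u) \<le> fill_prob p n ^ s * fill_prob p m ^ t * exp 9" .
        have "m + n \<le> nat \<lfloor>4 * cutoff p\<rfloor>" "m + s + (n + t) \<le> nat \<lfloor>4 * cutoff p\<rfloor>"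
          using m(2) n(2) ms by (linarith)+
        then have dec: "nat \<lfloor>4 * cutoff p\<rfloor> - (m + s + (n + t)) < nat \<lfloor>4 * cutoff p\<rfloor> - (m + n)"
          using grow by linarith
        have big: "1 \<le> sqrt p * real (m + s)" "1 \<le> sqrt p * real (n + t)"
          using m(1) n(1) p by (auto simp: distrib_left intro: add_increasing2)
        show "prob (never_stuck (a - int l) (c - int d) (m + l + r) (n + d + u)) \<le> growth_bound p (m + s) (n + t)"
          using less.hyps[OF dec big(1) ms(1) big(2) ms(2)] by (simp add: s_def t_def add.assoc)
      qed (use p fill_prob_nonneg[of p] in auto)
      also have "\<dots> = exp 9 * (fill_prob p n ^ s * fill_prob p m ^ t * growth_bound p (m + s) (n + t))"
        by simp
      also have "\<dots> \<le> exp 9 * (p ^ 2 * exp (- 17) * growth_bound p m n)"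
        using growth_bound_step[OF p(1) p1 m(1) n(1), of s t] st
        by (intro mult_left_mono) (auto simp: S_def T_def)
      also have "\<dots> = p ^ 2 * (exp 9 * exp (- 17)) * growth_bound p m n" by simp
      also have "exp 9 * exp (- 17) = exp (- 8 :: real)" by (simp add: exp_add[symmetric])
      finally show "prob (E z) \<le> p ^ 2 * exp (- 8) * growth_bound p m n" .
    qed
    also have "\<dots> = card (choices S T) * (p ^ 2 * exp (- 8)) * growth_bound p m n" by simp
    also have "\<dots> \<le> 1 * growth_bound p m n"
    proof (rule mult_right_mono)
      have one: "1 \<le> 1 / sqrt p" using p by simp
      \<comment> \<open>Each of the four entries of a choice takes at most \<open>4 / sqrt p\<close>
        values, which gives at most \<open>256 / p^2\<close> choices.\<close>
      have "real (S + 1) \<le> 4 / sqrt p" "real (T + 1) \<le> 4 / sqrt p" using Sb(4) Tb(4) one by auto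
      then have sq: "real (S + 1) ^ 2 \<le> (4 / sqrt p) ^ 2" "real (T + 1) ^ 2 \<le> (4 / sqrt p) ^ 2"
        by (auto intro!: power_mono)
      have "real (card (choices S T)) \<le> real ((S + 1)\<^sup>2 * (T + 1)\<^sup>2)"
        using card_choices by (intro of_nat_mono)
      also have "\<dots> = real (S + 1) ^ 2 * real (T + 1) ^ 2" by simp
      also have "\<dots> \<le> (4 / sqrt p) ^ 2 * (4 / sqrt p) ^ 2" by (intro mult_mono sq) auto
      also have "\<dots> = 256 / p ^ 2" using p by (simp add: power_divide power2_eq_square)
      finally have "card (choices S T) * (p ^ 2 * exp (- 8)) \<le> (256 / p ^ 2) * (p ^ 2 * exp (- 8))"
        by (rule mult_right_mono) simp
      also have "\<dots> = 2 ^ 8 / exp 1 ^ 8"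
        using p by (simp add: exp_of_nat_mult[symmetric] exp_minus field_simps)
      also have "\<dots> \<le> 1"
        using power_mono[of 2 "exp 1 :: real" 8] exp_ge_add_one_self[of "1 :: real"] by simp
      finally show "card (choices S T) * (p ^ 2 * exp (- 8)) \<le> 1" .
    qed (simp add: growth_bound_def)
    finally show ?thesis by simp
  qed
qed

lemma prob_growth_upper:
  assumes p: "0 < p" "p < 1 / 4"
  shows "prob_growth md p \<le> exp ((- 2 * (pi\<^sup>2 / 6) + 1540 * sqrt p * (ln (1 / p))\<^sup>2) / p)"
proof -
  interpret prob_space "init_law p" by (rule prob_space_init_law)
  define L where "L = ln (1 / p)"
  \<comment> \<open>The smallest scale at which the recursion is available. Growth up to this square
    is not charged, which costs only its potential, at most \<open>4 * L / sqrt p\<close>.\<close>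
  define A where "A = nat \<lceil>1 / sqrt p\<rceil>"
  have p1: "p < 1" "p \<le> 1 / 2" using p by auto
  have L1: "1 \<le> L"
  proof -
    have "4 \<le> 1 / p" using p by (simp add: field_simps)
    then have "exp 1 \<le> 1 / p" using exp_le by linarith
    then show ?thesis unfolding L_def using p by (simp add: ln_ge_iff)
  qed
  have one: "1 \<le> 1 / sqrt p" using p by simp
  have A: "1 / sqrt p \<le> A" "A \<le> 2 / sqrt p"
    unfolding A_def using one by linarith+
  have sA: "1 \<le> sqrt p * A" using A(1) p by (simp add: field_simps)
  have A0: "0 < A" using sA by (cases A) auto
  have sp: "1 / sqrt p \<le> 1 / p"
    using p by (intro divide_left_mono) (auto simp: real_sqrt_le_iff' real_le_lsqrt sqrt_le_D intro!: real_le_rsqrt simp: power2_eq_square)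
  have Acut: "A \<le> 2 * cutoff p"
  proof -
    have "2 / sqrt p \<le> 2 * (1 / p)" using sp by simp
    also have "\<dots> \<le> (16 * L) * (1 / p)" using L1 p by (intro mult_right_mono) auto
    finally show ?thesis using A(2) by (simp add: cutoff_def L_def)
  qed
  have "prob_growth md p \<le> prob (never_stuck 0 0 A A)"
    unfolding prob_growth_def
  proof (rule finite_measure_mono_AE)
    show "AE \<sigma> in init_law p. \<sigma> \<in> {\<sigma> \<in> space (init_law p). indefinite_growth md \<sigma>} \<longrightarrow> \<sigma> \<in> never_stuck 0 0 A A"
      using AE_only_origin_active[of p]
      by eventually_elim (use A0 in \<open>auto intro!: growth_never_stuck\<close>)
  qed (rule never_stuck_measurable)
  also have "\<dots> \<le> growth_bound p A A"
    by (rule prob_never_stuck) (use p sA Acut in auto)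
  \<comment> \<open>In units of \<open>L^2 / sqrt p\<close>, entropy contributes 1520 (the
    coefficient at most \<open>38 * L\<close>, two budgets of at most
    \<open>20 * L / sqrt p\<close>), the initial square 4 and the error in \<open>total_cost\<close>
    8; 1540 leaves room.\<close>
  also have "\<dots> \<le> exp ((- 2 * (pi\<^sup>2 / 6) + 1540 * sqrt p * L\<^sup>2) / p)"
    unfolding growth_bound_def exp_le_cancel_iff
  proof -
    have "cost p (Suc j) \<le> L" for j
      using cost_antimono[of p 1 "Suc j"] p by (simp add: L_def ln_div)
    then have "(\<Sum>j<A. cost p (Suc j)) \<le> A * L"
      using sum_bounded_above[of "{..<A}" "\<lambda>j. cost p (Suc j)" L] by simp
    also have "\<dots> \<le> 2 / sqrt p * L" using A(2) L1 by (intro mult_right_mono) auto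
    finally have pot: "potential p A A \<le> 4 * L / sqrt p" by (simp add: potential_def)
    have "ln (2 * cutoff p) \<le> 4 * L"
    proof -
      have "2 * cutoff p = 16 * L * (1 / p)" by (simp add: cutoff_def L_def)
      also have "\<dots> \<le> (1 / p) ^ 2 * exp L * (1 / p)"
      proof (intro mult_right_mono mult_mono)
        have "4 ^ 2 \<le> (1 / p) ^ 2" using p by (intro power_mono) (auto simp: field_simps)
        then show "16 \<le> (1 / p) ^ 2" by simp
        show "L \<le> exp L" using exp_ge_add_one_self[of L] by linarith
      qed (use L1 p in auto)
      also have "1 / p = exp L" using p by (simp add: L_def)
      also have "exp L ^ 2 * exp L * exp L = exp L ^ 4" by (simp add: power2_eq_square power4_eq_xxxx)
      also have "\<dots> = exp (4 * L)" by (simp add: exp_of_nat_mult[symmetric])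
      finally have "2 * cutoff p \<le> exp (4 * L)" .
      moreover have "0 < 2 * cutoff p" using L1 p by (simp add: cutoff_def L_def)
      ultimately show ?thesis by (metis exp_gt_zero ln_exp ln_le_cancel_iff)
    qed
    moreover have "p * cutoff p = 8 * L" using p by (simp add: cutoff_def L_def)
    moreover have "0 \<le> ln A" "0 \<le> p * A" using A0 p by auto
    ultimately have "ln (2 * cutoff p) + 2 * (p * cutoff p) - ln A - p * A \<le> 20 * L" by linarith
    then have ent: "step_budget p A \<le> 20 * L / sqrt p"
      unfolding step_budget_def using p by (intro divide_right_mono) auto
    have "(4 * L + 34) * (step_budget p A + step_budget p A) \<le> (38 * L) * (40 * L / sqrt p)"
      using ent L1 step_budget_nonneg[of p A] A0 Acut p by (intro mult_mono) auto
    also have "\<dots> = 1520 * L\<^sup>2 / sqrt p" by (simp add: power2_eq_square)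
    finally have ent2: "(4 * L + 34) * (step_budget p A + step_budget p A) \<le> 1520 * L\<^sup>2 / sqrt p" .
    have tot: "pi\<^sup>2 / 6 / p - 2 / sqrt p - 1 \<le> total_cost p"
      by (rule total_cost_lower) (use p in auto)
    have LL: "L \<le> L\<^sup>2" "1 \<le> L\<^sup>2" using L1 by (auto simp: power2_eq_square one_le_power intro: mult_left_le[of 1 L, simplified] order_trans[OF L1])
    have "4 * L / sqrt p \<le> 4 * L\<^sup>2 / sqrt p" using LL p by (intro divide_right_mono) auto
    moreover have "8 * (1 / sqrt p) \<le> 8 * (L\<^sup>2 / sqrt p)" using LL p by (intro mult_left_mono divide_right_mono) auto
    moreover have "0 \<le> L\<^sup>2 / sqrt p" using p by simp
    moreover have "(- 2 * (pi\<^sup>2 / 6) + 1540 * sqrt p * L\<^sup>2) / p = - 2 * (pi\<^sup>2 / 6 / p) + 1540 * (L\<^sup>2 / sqrt p)"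
    proof -
      have "sqrt p / p = 1 / sqrt p" using p by (metis less_imp_le real_div_sqrt inverse_divide inverse_eq_divide)
      then have "1540 * sqrt p * L\<^sup>2 / p = 1540 * L\<^sup>2 * (1 / sqrt p)" by (metis mult.assoc mult.commute times_divide_eq_right)
      then show ?thesis by (simp add: add_divide_distrib diff_divide_distrib)
    qed
    ultimately show "potential p A A - (2 * total_cost p - 2) +
        (4 * ln (1 / p) + 34) * (step_budget p A + step_budget p A)
        \<le> (- 2 * (pi\<^sup>2 / 6) + 1540 * sqrt p * L\<^sup>2) / p"
      using pot ent2 tot one unfolding L_def[symmetric] by simp
  qed
  finally show ?thesis by (simp add: L_def)
qed

subsection \<open>Growth of rectangles\<close>

lemma finite_linf_ball: "finite {y. linfdist y x \<le> r}"
proof (rule finite_subset)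
  show "{y. linfdist y x \<le> r} \<subseteq> {fst x - r..fst x + r} \<times> {snd x - r..snd x + r}"
    by (auto simp: linfdist_def)
qed simp

lemma finite_l1_ball: "finite {y. l1dist y x \<le> r \<and> P y}"
  by (rule finite_subset[OF _ finite_linf_ball[of x r]]) (use linfdist_le_l1dist order_trans in blast)

lemma step_local:
  assumes "\<And>y. linfdist y x \<le> 1 \<Longrightarrow> \<sigma> y = \<tau> y"
  shows "step md \<sigma> x = step md \<tau> x"
proof -
  have "\<sigma> x = \<tau> x" by (rule assms) (simp add: linfdist_def)
  moreover have "\<sigma> y = \<tau> y" if "l1dist y x \<le> 1" for y
    using assms that linfdist_le_l1dist order_trans by blast
  then have "{y. l1dist y x \<le> 1 \<and> \<sigma> y = Active} = {y. l1dist y x \<le> 1 \<and> \<tau> y = Active}" by auto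
  moreover have "\<sigma> y = \<tau> y" if "occ_dist md y x \<le> 1" for y
    using assms that occ_dist_between(1) order_trans by blast
  then have "(\<exists>y. occ_dist md y x \<le> 1 \<and> \<sigma> y = Active) \<longleftrightarrow> (\<exists>y. occ_dist md y x \<le> 1 \<and> \<tau> y = Active)"
    by (intro ex_cong1 conj_cong refl) simp
  ultimately show ?thesis unfolding step_def by (simp only:)
qed

text \<open>Influence spreads at unit speed in \<open>linfdist\<close>, so the state of a site at a
  fixed time is a function of finitely many initial states. This yields measurability of
  growth.\<close>

lemma evolve_local:
  assumes "\<And>y. linfdist y x \<le> int t \<Longrightarrow> \<sigma> y = \<tau> y"
  shows "evolve md t \<sigma> x = evolve md t \<tau> x"
  using assms
proof (induction t arbitrary: x)
  case 0
  then show ?case by (simp add: linfdist_def)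
next
  case (Suc t)
  show ?case
    unfolding evolve_Suc
  proof (rule step_local, rule Suc.IH, rule Suc.prems)
    fix y z assume "linfdist y x \<le> 1" "linfdist z y \<le> int t"
    then show "linfdist z x \<le> int (Suc t)" by (auto simp: linfdist_def)
  qed
qed

lemma growth_measurable: "{\<sigma>. indefinite_growth md \<sigma>} \<in> sets (init_law p)"
proof -
  have "{\<sigma>. evolve md t \<sigma> x = Active} \<in> sets (init_law p)" for t x
  proof (rule depends_on_finite_measurable[OF finite_linf_ball[of x "int t"]])
    show "depends_on {\<sigma>. evolve md t \<sigma> x = Active} {y. linfdist y x \<le> int t}"
      unfolding depends_on_def using evolve_local[of x t _ _ md] by (metis mem_Collect_eq)
  qed
  moreover have "{\<sigma>. indefinite_growth md \<sigma>} = (\<Inter>x. \<Union>t. {\<sigma>. evolve md t \<sigma> x = Active})"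
    by (auto simp: indefinite_growth_def)
  ultimately show ?thesis
    by (auto intro!: sets.countable_INT' sets.countable_UN)
qed

section \<open>Spread of activity along lines\<close>

definition activated :: "model \<Rightarrow> config \<Rightarrow> site set" where
  "activated md \<sigma> = {x. \<exists>t. evolve md t \<sigma> x = Active}"

lemma evolve_mono: "evolve md t \<sigma> x = Active \<Longrightarrow> evolve md (t + k) \<sigma> x = Active"
  by (induction k) (auto simp: evolve_Suc step_def)

lemma activated_initial: "\<sigma> x = Active \<Longrightarrow> x \<in> activated md \<sigma>"
  unfolding activated_def by (auto intro: exI[of _ 0])

text \<open>An active l1-neighbour activates an occupied site in either model, so this closure rule
  serves both.\<close>

lemma activated_filled:
  assumes "\<sigma> x \<noteq> Empty" "y \<in> activated md \<sigma>" "l1dist y x \<le> 1"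
  shows "x \<in> activated md \<sigma>"
proof -
  obtain t where t: "evolve md t \<sigma> y = Active" using assms(2) by (auto simp: activated_def)
  show ?thesis
  proof (cases "evolve md t \<sigma> x = Active")
    case True
    then show ?thesis by (auto simp: activated_def)
  next
    case False
    then have "evolve md t \<sigma> x = \<sigma> x" by (rule evolve_inactive)
    then have "evolve md t \<sigma> x = Occupied" using False assms(1) by (cases "\<sigma> x") auto
    moreover have "occ_dist md y x \<le> 1" using occ_dist_between(2)[of md y x] assms(3) by linarith
    then have "\<exists>y. occ_dist md y x \<le> 1 \<and> evolve md t \<sigma> y = Active" using t by blast
    ultimately have "evolve md (Suc t) \<sigma> x = Active"
      unfolding evolve_Suc step_def by (simp del: split_paired_Ex)
    then show ?thesis by (auto simp: activated_def)
  qed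
qed

lemma activated_two:
  assumes "y \<in> activated md \<sigma>" "z \<in> activated md \<sigma>" "y \<noteq> z" "l1dist y x \<le> 1" "l1dist z x \<le> 1"
  shows "x \<in> activated md \<sigma>"
proof (cases "\<sigma> x = Empty")
  case False
  then show ?thesis using activated_filled assms by blast
next
  case True
  obtain t s where "evolve md t \<sigma> y = Active" "evolve md s \<sigma> z = Active" using assms(1,2) by (auto simp: activated_def)
  then have act: "evolve md (t + s) \<sigma> y = Active" "evolve md (t + s) \<sigma> z = Active"
    using evolve_mono[of md t \<sigma> y s] evolve_mono[of md s \<sigma> z t] by (auto simp: add.commute)
  show ?thesis
  proof (cases "evolve md (t + s) \<sigma> x = Active")
    case True
    then show ?thesis by (auto simp: activated_def)
  next
    case False
    then have "evolve md (t + s) \<sigma> x = Empty" using True evolve_inactive by metis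
    moreover have "card {y, z} \<le> card {y. l1dist y x \<le> 1 \<and> evolve md (t + s) \<sigma> y = Active}"
      by (rule card_mono[OF finite_l1_ball]) (use act assms in auto)
    ultimately have "evolve md (Suc (t + s)) \<sigma> x = Active" using assms(3) by (auto simp: evolve_Suc step_def)
    then show ?thesis by (auto simp: activated_def)
  qed
qed

text \<open>A filled site of \<open>f\<close> is activated by its partner on the active line
  \<open>g\<close>; then each next site has two active neighbours, its predecessor on
  \<open>f\<close> and its partner on \<open>g\<close>. The parametrised form covers rows and
  columns, finite or infinite.\<close>

lemma activated_line:
  fixes f g :: "int \<Rightarrow> site"
  assumes near: "\<And>i. l1dist (f i) (f (i + 1)) \<le> 1" "\<And>i. l1dist (f (i + 1)) (f i) \<le> 1" "\<And>i. l1dist (g i) (f i) \<le> 1"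
    and ne: "\<And>i. f i \<noteq> g (i + 1)" "\<And>i. f (i + 1) \<noteq> g i"
    and conv: "\<forall>i\<in>I. \<forall>j\<in>I. {i..j} \<subseteq> I"
    and act: "\<And>i. i \<in> I \<Longrightarrow> g i \<in> activated md \<sigma>"
    and i0: "i0 \<in> I" "\<sigma> (f i0) \<noteq> Empty" and i: "i \<in> I"
  shows "f i \<in> activated md \<sigma>"
proof -
  have start: "f i0 \<in> activated md \<sigma>" using activated_filled[OF i0(2) act[OF i0(1)] near(3)] .
  show ?thesis
  proof (cases "i0 \<le> i")
    case True
    then have "i \<in> I \<longrightarrow> f i \<in> activated md \<sigma>"
    proof (induction i rule: int_ge_induct)
      case (step i)
      show ?case
      proof
        assume 1: "i + 1 \<in> I"
        then have "i \<in> I" using conv[rule_format, OF i0(1) 1] step.hyps by auto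
        then have "f i \<in> activated md \<sigma>" using step.IH by blast
        from activated_two[OF this act[OF 1] ne(1) near(1) near(3)] show "f (i + 1) \<in> activated md \<sigma>" .
      qed
    qed (use start in simp)
    then show ?thesis using i by simp
  next
    case False
    then have "i \<le> i0" by simp
    then have "i \<in> I \<longrightarrow> f i \<in> activated md \<sigma>"
    proof (induction i rule: int_le_induct)
      case (step i)
      show ?case
      proof
        assume 1: "i - 1 \<in> I"
        then have "i \<in> I" using conv[rule_format, OF 1 i0(1)] step.hyps by auto
        then have "f (i - 1 + 1) \<in> activated md \<sigma>" using step.IH by simp
        from activated_two[OF this act[OF 1] ne(2) near(2) near(3)] show "f (i - 1) \<in> activated md \<sigma>" .
      qed
    qed (use start in simp)
    then show ?thesis using i by simp
  qed
qed

lemma activated_column: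
  assumes "\<bar>x' - x\<bar> = 1" "\<forall>i\<in>I. \<forall>j\<in>I. {i..j} \<subseteq> I"
    "{x'} \<times> I \<subseteq> activated md \<sigma>" "\<sigma> \<in> some_filled ({x} \<times> I)"
  shows "{x} \<times> I \<subseteq> activated md \<sigma>"
proof -
  obtain i0 where "i0 \<in> I" "\<sigma> (x, i0) \<noteq> Empty" using assms(4) by (auto simp: some_filled_def)
  note i0 = this
  have "(x, i) \<in> activated md \<sigma>" if "i \<in> I" for i
  proof (rule activated_line[where f="\<lambda>i. (x, i)" and g="\<lambda>i. (x', i)" and \<sigma>=\<sigma>, OF _ _ _ _ _ assms(2) _ i0 that])
  qed (use assms(1,3) in \<open>auto simp: l1dist_def\<close>)
  then show ?thesis by auto
qed

lemma activated_row:
  assumes "\<bar>y' - y\<bar> = 1" "\<forall>i\<in>I. \<forall>j\<in>I. {i..j} \<subseteq> I"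
    "I \<times> {y'} \<subseteq> activated md \<sigma>" "\<sigma> \<in> some_filled (I \<times> {y})"
  shows "I \<times> {y} \<subseteq> activated md \<sigma>"
proof -
  obtain i0 where "i0 \<in> I" "\<sigma> (i0, y) \<noteq> Empty" using assms(4) by (auto simp: some_filled_def)
  note i0 = this
  have "(i, y) \<in> activated md \<sigma>" if "i \<in> I" for i
  proof (rule activated_line[where f="\<lambda>i. (i, y)" and g="\<lambda>i. (i, y')" and \<sigma>=\<sigma>, OF _ _ _ _ _ assms(2) _ i0 that])
  qed (use assms(1,3) in \<open>auto simp: l1dist_def\<close>)
  then show ?thesis by auto
qed

lemma some_filled_mono: "S \<subseteq> T \<Longrightarrow> \<sigma> \<in> some_filled S \<Longrightarrow> \<sigma> \<in> some_filled T"
  by (auto simp: some_filled_def)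

lemma grow_columns:
  assumes "rect 0 0 m n \<subseteq> activated md \<sigma>" "0 < m"
    "\<And>i. i < k \<Longrightarrow> \<sigma> \<in> some_filled ({int (m + i)} \<times> {0..<int n})"
  shows "rect 0 0 (m + k) n \<subseteq> activated md \<sigma>"
  using assms(3)
proof (induction k)
  case 0
  then show ?case using assms by simp
next
  case (Suc k)
  then have IH: "rect 0 0 (m + k) n \<subseteq> activated md \<sigma>" by simp
  then have "{int (m + k) - 1} \<times> {0..<int n} \<subseteq> activated md \<sigma>" using assms(2) by (auto simp: rect_def)
  then have "{int (m + k)} \<times> {0..<int n} \<subseteq> activated md \<sigma>"
    using Suc.prems[of k] by (intro activated_column[of "int (m + k) - 1" "int (m + k)"]) auto
  moreover have "rect 0 0 (m + Suc k) n \<subseteq> rect 0 0 (m + k) n \<union> {int (m + k)} \<times> {0..<int n}"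
    by (auto simp: rect_def)
  ultimately show ?case using IH by blast
qed

lemma grow_rows:
  assumes "rect 0 0 m n \<subseteq> activated md \<sigma>" "0 < n"
    "\<And>i. i < k \<Longrightarrow> \<sigma> \<in> some_filled ({0..<int m} \<times> {int (n + i)})"
  shows "rect 0 0 m (n + k) \<subseteq> activated md \<sigma>"
  using assms(3)
proof (induction k)
  case 0
  then show ?case using assms by simp
next
  case (Suc k)
  then have IH: "rect 0 0 m (n + k) \<subseteq> activated md \<sigma>" by simp
  then have "{0..<int m} \<times> {int (n + k) - 1} \<subseteq> activated md \<sigma>" using assms(2) by (auto simp: rect_def)
  then have "{0..<int m} \<times> {int (n + k)} \<subseteq> activated md \<sigma>"
    using Suc.prems[of k] by (intro activated_row[of "int (n + k) - 1" "int (n + k)"]) auto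
  moreover have "rect 0 0 m (n + Suc k) \<subseteq> rect 0 0 m (n + k) \<union> {0..<int m} \<times> {int (n + k)}"
    by (auto simp: rect_def)
  ultimately show ?case using IH by blast
qed

section \<open>Diagonal growth of squares and passage to the whole plane\<close>

abbreviation square :: "nat \<Rightarrow> site set" where
  "square k \<equiv> rect 0 0 k k"

text \<open>The row comes after the column and is therefore one site longer. The corner
  \<open>(k, k)\<close> belongs to the row only, which keeps the two requirements on disjoint sets
  of sites.\<close>

definition diagonal_step :: "nat \<Rightarrow> config set" where
  "diagonal_step k = some_filled ({int k} \<times> {0..<int k}) \<inter> some_filled ({0..<int (Suc k)} \<times> {int k})"

lemma diagonal_step_grows:
  assumes "square k \<subseteq> activated md \<sigma>" "0 < k" "\<sigma> \<in> diagonal_step k"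
  shows "square (Suc k) \<subseteq> activated md \<sigma>"
proof -
  have "rect 0 0 (k + 1) k \<subseteq> activated md \<sigma>"
    by (rule grow_columns) (use assms in \<open>auto simp: diagonal_step_def\<close>)
  then have "rect 0 0 (k + 1) (k + 1) \<subseteq> activated md \<sigma>"
    by (rule grow_rows) (use assms in \<open>auto simp: diagonal_step_def\<close>)
  then show ?thesis by simp
qed

lemma depends_diagonal_step: "depends_on (diagonal_step k) (square (Suc k) - square k)"
  unfolding diagonal_step_def
  by (rule depends_on_mono[OF depends_on_Int[OF depends_some_filled depends_some_filled]]) (auto simp: rect_def)

lemma diagonal_step_measurable: "diagonal_step k \<in> sets (init_law p)"
  by (rule depends_on_finite_measurable[OF _ depends_diagonal_step]) simp

lemma prob_diagonal_step:
  assumes "0 \<le> p" "p \<le> 1"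
  shows "measure (init_law p) (diagonal_step k) = fill_prob p k * fill_prob p (Suc k)"
  unfolding diagonal_step_def
  by (subst indep_depends_on[OF some_filled_measurable depends_some_filled some_filled_measurable depends_some_filled])
    (use assms in \<open>auto simp: prob_some_filled card_cartesian_product nat_add_distrib\<close>)

text \<open>Squares with corner at the origin exhaust only a quadrant. Infinite columns are then
  added on the left and full rows below; each needs a single filled site, which exists almost surely
  by \<open>AE_some_filled\<close>.\<close>

lemma plane_from_quadrant:
  assumes quad: "\<And>k. 0 < k \<Longrightarrow> square k \<subseteq> activated md \<sigma>"
    and cols: "\<And>x. \<sigma> \<in> some_filled ({x} \<times> {0..})" and rows: "\<And>y. \<sigma> \<in> some_filled ({0..} \<times> {y})"
  shows "indefinite_growth md \<sigma>"
proof -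
  have half: "{- int a..} \<times> {0..} \<subseteq> activated md \<sigma>" for a
  proof (induction a)
    case 0
    show ?case
    proof
      fix z assume "z \<in> {- int 0..} \<times> {0 :: int..}"
      then have "z \<in> square (nat (fst z) + nat (snd z) + 1)" by (auto simp: rect_def)
      then show "z \<in> activated md \<sigma>" using quad[of "nat (fst z) + nat (snd z) + 1"] by auto
    qed
  next
    case (Suc a)
    have "{- int (Suc a)} \<times> {0..} \<subseteq> activated md \<sigma>"
      by (rule activated_column[of "- int a"]) (use Suc cols in auto)
    moreover have "{- int (Suc a)..} \<times> {0 :: int..} \<subseteq> {- int a..} \<times> {0..} \<union> {- int (Suc a)} \<times> {0..}" by auto
    ultimately show ?case using Suc by blast
  qed
  have upper: "UNIV \<times> {0..} \<subseteq> activated md \<sigma>"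
  proof
    fix z :: site assume "z \<in> UNIV \<times> {0..}"
    then have "z \<in> {- int (nat (- fst z))..} \<times> {0..}" by auto
    then show "z \<in> activated md \<sigma>" using half by blast
  qed
  have all: "UNIV \<times> {- int b..} \<subseteq> activated md \<sigma>" for b
  proof (induction b)
    case (Suc b)
    have "UNIV \<times> {- int (Suc b)} \<subseteq> activated md \<sigma>"
      by (rule activated_row[of "- int b"])
        (use Suc some_filled_mono[OF _ rows[of "- int (Suc b)"], of "UNIV \<times> {- int (Suc b)}"] in auto)
    moreover have "UNIV \<times> {- int (Suc b)..} \<subseteq> UNIV \<times> {- int b..} \<union> UNIV \<times> {- int (Suc b)}" by auto
    ultimately show ?case using Suc by blast
  qed (use upper in simp)
  have "z \<in> activated md \<sigma>" for z
  proof -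
    have "z \<in> UNIV \<times> {- int (nat (- snd z))..}" by (cases z) auto
    then show ?thesis using all by blast
  qed
  then show ?thesis by (auto simp: indefinite_growth_def activated_def)
qed

lemma AE_some_filled:
  fixes f :: "nat \<Rightarrow> site"
  assumes p: "0 < p" "p \<le> 1" and f: "inj f" "range f \<subseteq> S"
  shows "AE \<sigma> in init_law p. \<sigma> \<in> some_filled S"
proof -
  interpret prob_space "init_law p" by (rule prob_space_init_law)
  define N where "N = (\<Inter>n::nat. all_empty (f ` {..<n}))"
  have N: "N \<in> events" unfolding N_def by (intro sets.countable_INT') (auto intro: all_empty_measurable)
  have "prob N \<le> (1 - p) ^ n" for n
  proof -
    have "prob N \<le> prob (all_empty (f ` {..<n}))"
      by (rule finite_measure_mono) (auto simp: N_def intro: all_empty_measurable)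
    also have "\<dots> = (1 - p) ^ n"
      using prob_all_empty[of p "f ` {..<n}"] p f by (simp add: card_image inj_on_subset)
    finally show ?thesis .
  qed
  moreover have "(\<lambda>n. (1 - p) ^ n) \<longlonglongrightarrow> 0" using p by (intro LIMSEQ_realpow_zero) auto
  ultimately have "prob N \<le> 0" by (intro LIMSEQ_le_const) auto
  then have "N \<in> null_sets (init_law p)"
    using N by (simp add: null_sets_def emeasure_eq_measure measure_le_0_iff)
  then show ?thesis
  proof (rule AE_I')
    show "{\<sigma> \<in> space (init_law p). \<sigma> \<notin> some_filled S} \<subseteq> N"
      using f(2) by (auto simp: N_def all_empty_def some_filled_def)
  qed
qed

subsection \<open>The lower bound\<close>

text \<open>The event looks only at sites of the square, so that events for successive shells
  multiply. The guard at the origin is there because filled-site events do not separate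
  \<open>Occupied\<close> from \<open>Active\<close>; it holds almost surely.\<close>

definition grown :: "model \<Rightarrow> real \<Rightarrow> nat \<Rightarrow> real \<Rightarrow> bool" where
  "grown md p k v \<longleftrightarrow> (\<exists>X. X \<in> sets (init_law p) \<and> depends_on X (square k) \<and> v \<le> measure (init_law p) X \<and>
     (\<forall>\<sigma>\<in>X. \<sigma> (0, 0) \<noteq> Occupied \<longrightarrow> square k \<subseteq> activated md \<sigma>))"

lemma grown_Suc_0:
  assumes "0 \<le> p" "p \<le> 1"
  shows "grown md p (Suc 0) p"
  unfolding grown_def
proof (intro exI conjI ballI impI)
  have sq: "square (Suc 0) = {(0, 0)}" by (auto simp: rect_def)
  show "depends_on (some_filled {(0, 0)}) (square (Suc 0))"
    unfolding sq by (rule depends_some_filled)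
  show "p \<le> measure (init_law p) (some_filled {(0, 0)})"
    using prob_some_filled[of p "{(0, 0)}"] assms by simp
  fix \<sigma> :: config assume "\<sigma> \<in> some_filled {(0, 0)}" "\<sigma> (0, 0) \<noteq> Occupied"
  then have "\<sigma> (0, 0) = Active" by (cases "\<sigma> (0, 0)") (auto simp: some_filled_def)
  then show "square (Suc 0) \<subseteq> activated md \<sigma>" unfolding sq using activated_initial by simp
qed (simp add: some_filled_measurable)

lemma grown_extend:
  assumes "grown md p k v" "k \<le> k'"
    and Y: "Y \<in> sets (init_law p)" "depends_on Y (square k' - square k)" "w \<le> measure (init_law p) Y"
    and grow: "\<And>\<sigma>. \<sigma> \<in> Y \<Longrightarrow> square k \<subseteq> activated md \<sigma> \<Longrightarrow> square k' \<subseteq> activated md \<sigma>"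
    and nonneg: "0 \<le> v" "0 \<le> w"
  shows "grown md p k' (v * w)"
proof -
  obtain X where X: "X \<in> sets (init_law p)" "depends_on X (square k)" "v \<le> measure (init_law p) X"
    "\<And>\<sigma>. \<sigma> \<in> X \<Longrightarrow> \<sigma> (0, 0) \<noteq> Occupied \<Longrightarrow> square k \<subseteq> activated md \<sigma>"
    using assms(1) unfolding grown_def by blast
  have "v * w \<le> measure (init_law p) X * measure (init_law p) Y"
    using X(3) Y(3) nonneg by (intro mult_mono) auto
  also have "\<dots> = measure (init_law p) (X \<inter> Y)"
    by (rule indep_depends_on[OF X(1,2) Y(1,2), symmetric]) auto
  finally have "v * w \<le> measure (init_law p) (X \<inter> Y)" .
  moreover have "depends_on (X \<inter> Y) (square k')"
    by (rule depends_on_mono[OF depends_on_Int[OF X(2) Y(2)]]) (use assms(2) in \<open>auto simp: rect_def\<close>)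
  moreover have "square k' \<subseteq> activated md \<sigma>" if "\<sigma> \<in> X \<inter> Y" "\<sigma> (0, 0) \<noteq> Occupied" for \<sigma>
    using grow X(4) that by blast
  ultimately show ?thesis unfolding grown_def using X(1) Y(1) by blast
qed

definition diagonal_steps :: "nat \<Rightarrow> nat \<Rightarrow> config set" where
  "diagonal_steps k L = (\<Inter>i\<in>{..<L}. diagonal_step (k + i))"

lemma depends_diagonal_steps: "depends_on (diagonal_steps k L) (square (k + L) - square k)"
  unfolding diagonal_steps_def
  by (rule depends_on_mono[OF depends_on_INT[OF depends_diagonal_step]]) (auto simp: rect_def)

lemma diagonal_steps_measurable: "diagonal_steps k L \<in> sets (init_law p)"
  by (rule depends_on_finite_measurable[OF _ depends_diagonal_steps]) simp

lemma diagonal_steps_grow: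
  assumes "square k \<subseteq> activated md \<sigma>" "0 < k" "\<sigma> \<in> diagonal_steps k L"
  shows "square (k + L) \<subseteq> activated md \<sigma>"
  using assms(3)
proof (induction L)
  case (Suc L)
  then have "\<sigma> \<in> diagonal_steps k L" "\<sigma> \<in> diagonal_step (k + L)" by (auto simp: diagonal_steps_def)
  with Suc.IH show ?case using diagonal_step_grows[of "k + L" md \<sigma>] assms(2) by simp
qed (use assms in simp)

lemma prob_diagonal_steps:
  assumes "0 \<le> p" "p \<le> 1"
  shows "measure (init_law p) (diagonal_steps k L) = (\<Prod>i<L. fill_prob p (k + i) * fill_prob p (Suc (k + i)))"
proof -
  have "measure (init_law p) (diagonal_steps k L) = (\<Prod>i<L. measure (init_law p) (diagonal_step (k + i)))"
    unfolding diagonal_steps_def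
    by (rule indep_depends_on_family[OF _ _ depends_diagonal_step])
      (auto simp: disjoint_family_on_def rect_def)
  then show ?thesis by (simp add: prob_diagonal_step[OF assms])
qed

text \<open>The square still grows, but by another route: all rows are added before the column with index
  $k + i$, whose only filled sites are too high to be reached in the diagonal order. There are about
  $1/p$ positions for such a site, so detours together have probability comparable to that of the
  diagonal route.\<close>

definition detour :: "nat \<Rightarrow> nat \<Rightarrow> nat \<Rightarrow> config set" where
  "detour k L i =
    (all_empty ({int (k + i)} \<times> {0..<int (k + i)}) \<inter> some_filled ({int (k + i)} \<times> {int (k + i)..<int (k + L)})) \<inter>
    ((\<Inter>j\<in>{..<L} - {i}. some_filled ({int (k + j)} \<times> {0..<int k})) \<inter>
     (\<Inter>j\<in>{..<L}. some_filled ({0..<int k} \<times> {int (k + j)})))"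

lemma depends_detour:
  assumes "i < L"
  shows "depends_on (detour k L i) (square (k + L) - square k)"
  unfolding detour_def
  by (rule depends_on_mono[OF depends_on_Int[OF depends_on_Int[OF depends_all_empty depends_some_filled]
        depends_on_Int[OF depends_Inter_some_filled depends_Inter_some_filled]]])
    (use assms in \<open>auto simp: rect_def\<close>)

lemma detour_measurable: "i < L \<Longrightarrow> detour k L i \<in> sets (init_law p)"
  by (rule depends_on_finite_measurable[OF _ depends_detour]) simp_all

lemma detour_grows:
  assumes "square k \<subseteq> activated md \<sigma>" "0 < k" "i < L" "\<sigma> \<in> detour k L i"
  shows "square (k + L) \<subseteq> activated md \<sigma>"
proof -
  have "rect 0 0 k (k + L) \<subseteq> activated md \<sigma>"
    by (rule grow_rows) (use assms in \<open>auto simp: detour_def\<close>)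
  then show ?thesis
  proof (rule grow_columns)
    fix j assume j: "j < L"
    show "\<sigma> \<in> some_filled ({int (k + j)} \<times> {0..<int (k + L)})"
    proof (cases "j = i")
      case True
      then have "\<sigma> \<in> some_filled ({int (k + j)} \<times> {int (k + i)..<int (k + L)})" using assms(4) by (auto simp: detour_def)
      then show ?thesis by (rule some_filled_mono[rotated]) auto
    next
      case False
      then have "\<sigma> \<in> some_filled ({int (k + j)} \<times> {0..<int k})" using assms(4) j by (auto simp: detour_def)
      then show ?thesis by (rule some_filled_mono[rotated]) auto
    qed
  qed (rule assms)
qed

lemma prob_detour:
  assumes p: "0 \<le> p" "p \<le> 1" and i: "i < L"
  shows "measure (init_law p) (detour k L i) =
    (1 - p) ^ (k + i) * fill_prob p (L - i) * (fill_prob p k ^ (L - 1) * fill_prob p k ^ L)"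
proof -
  let ?A = "all_empty ({int (k + i)} \<times> {0..<int (k + i)})"
  let ?B = "some_filled ({int (k + i)} \<times> {int (k + i)..<int (k + L)})"
  let ?C = "\<Inter>j\<in>{..<L} - {i}. some_filled ({int (k + j)} \<times> {0..<int k})"
  let ?D = "\<Inter>j\<in>{..<L}. some_filled ({0..<int k} \<times> {int (k + j)})"
  have dC: "depends_on ?C (\<Union>j\<in>{..<L} - {i}. {int (k + j)} \<times> {0..<int k})"
    and dD: "depends_on ?D (\<Union>j\<in>{..<L}. {0..<int k} \<times> {int (k + j)})" by (rule depends_Inter_some_filled)+
  have mC: "?C \<in> sets (init_law p)" and mD: "?D \<in> sets (init_law p)"
    by (rule depends_on_finite_measurable[OF _ dC] depends_on_finite_measurable[OF _ dD]; simp)+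
  have mA: "?A \<in> sets (init_law p)" and mB: "?B \<in> sets (init_law p)"
    by (simp_all add: all_empty_measurable some_filled_measurable)
  have "measure (init_law p) (detour k L i) = measure (init_law p) (?A \<inter> ?B) * measure (init_law p) (?C \<inter> ?D)"
    unfolding detour_def
    by (rule indep_depends_on[OF _ depends_on_Int[OF depends_all_empty depends_some_filled] _ depends_on_Int[OF dC dD]])
      (use mA mB mC mD in auto)
  also have "measure (init_law p) (?A \<inter> ?B) = measure (init_law p) ?A * measure (init_law p) ?B"
    by (rule indep_depends_on[OF mA depends_all_empty mB depends_some_filled]) auto
  also have "measure (init_law p) (?C \<inter> ?D) = measure (init_law p) ?C * measure (init_law p) ?D"
    by (rule indep_depends_on[OF mC dC mD dD]) auto
  also have "measure (init_law p) ?A = (1 - p) ^ (k + i)"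
    by (subst prob_all_empty) (use p in \<open>auto simp: card_cartesian_product nat_add_distrib\<close>)
  also have "measure (init_law p) ?B = fill_prob p (L - i)"
  proof -
    have "nat (int (k + L) - int (k + i)) = L - i" using i by simp
    then show ?thesis
      using prob_some_filled[of p "{int (k + i)} \<times> {int (k + i)..<int (k + L)}"] p
      by (simp add: card_cartesian_product)
  qed
  also have "measure (init_law p) ?C = fill_prob p k ^ (L - 1)"
    using i p by (subst prob_Inter_some_filled) (auto simp: disjoint_family_on_def card_cartesian_product)
  also have "measure (init_law p) ?D = fill_prob p k ^ L"
    using i p by (subst prob_Inter_some_filled) (auto simp: disjoint_family_on_def card_cartesian_product)
  finally show ?thesis .
qed

text \<open>Detour \<open>i\<close> keeps column \<open>k + i\<close> empty below height
  \<open>k + i\<close>, where the diagonal order and every other detour require a filled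
  site.\<close>

lemma detour_disjoint:
  assumes "i < L"
  shows "j < L \<Longrightarrow> i \<noteq> j \<Longrightarrow> detour k L i \<inter> detour k L j = {}" "diagonal_steps k L \<inter> detour k L i = {}"
proof -
  have e: "\<sigma> (int (k + i), y) = Empty" if "\<sigma> \<in> detour k L i" "0 \<le> y" "y < int (k + i)" for \<sigma> y
    using that by (auto simp: detour_def all_empty_def)
  show "detour k L i \<inter> detour k L j = {}" if "j < L" "i \<noteq> j"
  proof -
    have "\<exists>y\<in>{0..<int k}. \<sigma> (int (k + i), y) \<noteq> Empty" if "\<sigma> \<in> detour k L j" for \<sigma>
      using that assms \<open>i \<noteq> j\<close> by (auto simp: detour_def some_filled_def)
    then show ?thesis using e by fastforce
  qed
  have "\<exists>y\<in>{0..<int (k + i)}. \<sigma> (int (k + i), y) \<noteq> Empty" if "\<sigma> \<in> diagonal_steps k L" for \<sigma>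
    using that assms by (auto simp: diagonal_steps_def diagonal_step_def some_filled_def)
  then show "diagonal_steps k L \<inter> detour k L i = {}" using e by fastforce
qed

text \<open>\<open>exp(-6)\<close> bounds the probability of the empty lower part of a column,
  \<open>exp(-16)\<close> the ratio of \<open>f^(2L)\<close> to the diagonal probability, and 1/8
  comes from the number of places for the decisive site.\<close>

definition gain :: real where
  "gain = exp (- 22) / 8"

text \<open>For indices in the first half, at least \<open>L / 2\<close> sites of the column remain
  above the emptied part.\<close>

definition with_detours :: "nat \<Rightarrow> nat \<Rightarrow> config set" where
  "with_detours k L = diagonal_steps k L \<union> (\<Union>i\<in>{..<(L + 1) div 2}. detour k L i)"

text \<open>At side lengths between \<open>1/p\<close> and \<open>3/p\<close> a line is filled with
  probability at least 1/2 and empty with probability at least \<open>exp(-6)\<close>. Each detour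
  thus has probability at least a constant times \<open>p * L * f^(2L)\<close>, and about
  \<open>L / 2\<close> disjoint ones are available.\<close>

lemma prob_with_detours:
  assumes p: "0 < p" "p \<le> 1 / 4" and L: "1 / sqrt p \<le> L" "L \<le> 2 / sqrt p"
    and k: "1 / p \<le> k" "k + L \<le> 3 / p"
  shows "(1 + gain) * (\<Prod>i<L. fill_prob p (k + i) * fill_prob p (Suc (k + i)))
    \<le> measure (init_law p) (with_detours k L)"
proof -
  interpret prob_space "init_law p" by (rule prob_space_init_law)
  define f where "f = fill_prob p k"
  define h where "h = (L + 1) div 2"
  have p1: "0 \<le> p" "p \<le> 1" "p < 1" using p by auto
  have L0: "0 < L" using L(1) p by (cases L) auto
  have hL: "real L / 2 \<le> real h" "h \<le> L" unfolding h_def using L0 by (auto simp: of_nat_diff)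
  have s: "sqrt p * sqrt p = p" using p by simp
  have sL: "1 \<le> sqrt p * L" "sqrt p * L \<le> 2" using L p by (auto simp: field_simps)
  have pLL: "1 \<le> p * L * L" "p * L * L \<le> 4"
  proof -
    have e: "p * L * L = (sqrt p * L) * (sqrt p * L)" by (metis s mult.assoc mult.left_commute)
    show "1 \<le> p * L * L" unfolding e using mult_mono[of 1 "sqrt p * L" 1 "sqrt p * L"] sL by simp
    show "p * L * L \<le> 4" unfolding e using mult_mono[of "sqrt p * L" 2 "sqrt p * L" 2] sL by simp
  qed
  have pL: "p * L \<le> 1"
  proof -
    have "sqrt p \<le> 1 / 2" using p by (intro real_le_lsqrt) (auto simp: power2_eq_square)
    then have "sqrt p * (sqrt p * L) \<le> (1 / 2) * 2" using sL p by (intro mult_mono) auto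
    then show ?thesis using p by (simp add: mult.assoc[symmetric])
  qed
  have f_half: "1 / 2 \<le> f"
  proof -
    have "1 \<le> p * k" using k(1) p by (simp add: field_simps)
    then have "1 / 2 \<le> p * k / (1 + p * k)" by (simp add: field_simps)
    then show ?thesis using fill_prob_ge[OF p(1) p1(3), of k] unfolding f_def by linarith
  qed
  have f1: "f \<le> 1" unfolding f_def using p1 fill_prob_le_1 by simp
  have empty: "exp (- 6) \<le> (1 - p) ^ (k + i)" if "i < h" for i
  proof -
    have "p * (k + L) \<le> 3" using k(2) p by (simp add: field_simps)
    then have "exp (- 6) \<le> exp (real (k + L) * (- 2 * p))" by (simp add: algebra_simps)
    also have "\<dots> = exp (- 2 * p) ^ (k + L)" by (rule exp_of_nat_mult)
    also have "\<dots> \<le> (1 - p) ^ (k + L)"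
    proof (rule power_mono)
      have "- p - 2 * p\<^sup>2 \<le> ln (1 - p)" by (rule ln_one_minus_pos_lower_bound) (use p in auto)
      moreover have "2 * p\<^sup>2 \<le> p" using p by (simp add: power2_eq_square)
      ultimately have "- 2 * p \<le> ln (1 - p)" by simp
      then show "exp (- 2 * p) \<le> 1 - p" using p by (simp add: ln_ge_iff)
    qed simp
    also have "\<dots> \<le> (1 - p) ^ (k + i)" using that hL p by (intro power_decreasing) auto
    finally show ?thesis .
  qed
  have helped: "p * L / 4 \<le> fill_prob p (L - i)" if "i < h" for i
  proof -
    have "real L / 2 \<le> real (L - i)" using that unfolding h_def by linarith
    then have "p * L / 2 \<le> p * real (L - i)" using p mult_left_mono[of "real L / 2" "real (L - i)" p] by simp
    moreover have "p * real (L - i) \<le> p * L" using p by (intro mult_left_mono) auto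
    then have "1 + p * real (L - i) \<le> 2" using pL by linarith
    ultimately have "(p * L / 2) / 2 \<le> p * real (L - i) / (1 + p * real (L - i))"
      using p by (intro frac_le) (auto intro: add_pos_nonneg)
    then show ?thesis using fill_prob_ge[OF p(1) p1(3), of "L - i"] by linarith
  qed
  have det: "exp (- 6) * (p * L / 4) * f ^ (2 * L) \<le> prob (detour k L i)" if "i < h" for i
  proof -
    have "i < L" using that hL by simp
    have "f ^ (2 * L) \<le> f ^ (L - 1) * f ^ L"
      unfolding power_add[symmetric] using f_half f1 by (intro power_decreasing) auto
    then have "exp (- 6) * (p * L / 4) * f ^ (2 * L) \<le>
        (1 - p) ^ (k + i) * fill_prob p (L - i) * (f ^ (L - 1) * f ^ L)"
      using empty[OF that] helped[OF that] p p1 f_half by (intro mult_mono) (auto intro!: mult_nonneg_nonneg fill_prob_nonneg)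
    then show ?thesis using prob_detour[of p i L k] p1 \<open>i < L\<close> by (simp add: f_def)
  qed
  \<comment> \<open>Each of the \<open>2 * L\<close> factors is at most
    \<open>f * (1 + 2 * p * L)\<close>; since \<open>p * L^2 <= 4\<close>, the product exceeds
    \<open>f^(2L)\<close> by at most the factor \<open>exp 16\<close>.\<close>
  have steps: "(\<Prod>i<L. fill_prob p (k + i) * fill_prob p (Suc (k + i))) \<le> exp 16 * f ^ (2 * L)"
  proof -
    have "(\<Prod>i<L. fill_prob p (k + i) * fill_prob p (Suc (k + i))) \<le> (\<Prod>i<L. fill_prob p (k + L) * fill_prob p (k + L))"
      by (intro prod_mono conjI mult_mono mult_nonneg_nonneg fill_prob_mono fill_prob_nonneg p1) auto
    also have "\<dots> = fill_prob p (k + L) ^ (2 * L)" by (simp add: power_mult power2_eq_square)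
    also have "\<dots> \<le> (f * (1 + 2 * (p * L))) ^ (2 * L)"
    proof (rule power_mono)
      have "1 - p * L \<le> (1 - p) ^ L" using Bernoulli_inequality[of "- p" L] p by (simp add: mult.commute)
      then have "(1 - p) ^ k * (1 - (1 - p) ^ L) \<le> 1 * (p * L)"
        using p by (intro mult_mono) (auto simp: power_le_one)
      then have "fill_prob p (k + L) \<le> f + p * L"
        unfolding f_def fill_prob_def by (simp add: power_add algebra_simps)
      also have "p * L \<le> f * (2 * (p * L))" using f_half mult_right_mono[of 1 "2 * f" "p * L"] p by simp
      finally show "fill_prob p (k + L) \<le> f * (1 + 2 * (p * L))" by (simp add: algebra_simps)
    qed (simp add: fill_prob_nonneg p1)
    also have "\<dots> = (1 + 2 * (p * L)) ^ (2 * L) * f ^ (2 * L)" by (simp add: power_mult_distrib)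
    also have "(1 + 2 * (p * L)) ^ (2 * L) \<le> exp (2 * (p * L)) ^ (2 * L)"
      using p by (intro power_mono) auto
    also have "exp (2 * (p * L)) ^ (2 * L) = exp (4 * (p * L * L))"
      by (simp add: exp_of_nat_mult[symmetric] mult_ac)
    also have "\<dots> \<le> exp 16" using pLL by simp
    finally show ?thesis using f_half by (simp add: mult_right_mono)
  qed
  have "gain * (\<Prod>i<L. fill_prob p (k + i) * fill_prob p (Suc (k + i))) \<le> gain * (exp 16 * f ^ (2 * L))"
    using steps by (intro mult_left_mono) (auto simp: gain_def)
  also have "\<dots> = exp (- 6) * (1 / 8) * f ^ (2 * L)"
  proof -
    have "exp (- 22) * exp 16 = exp (- 6 :: real)" by (simp add: exp_add[symmetric])
    then show ?thesis by (simp add: gain_def)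
  qed
  also have "\<dots> \<le> exp (- 6) * (real h * (p * L / 4)) * f ^ (2 * L)"
  proof -
    have "1 / 8 \<le> (real L / 2) * (p * L / 4)" using pLL by (simp add: mult_ac)
    also have "\<dots> \<le> real h * (p * L / 4)" using hL p by (intro mult_right_mono) auto
    finally show ?thesis using f_half by (intro mult_right_mono mult_left_mono) auto
  qed
  also have "\<dots> = (\<Sum>i<h. exp (- 6) * (p * L / 4) * f ^ (2 * L))" by simp
  also have "\<dots> \<le> (\<Sum>i<h. prob (detour k L i))" using det by (intro sum_mono) auto
  also have "\<dots> = prob (\<Union>i\<in>{..<h}. detour k L i)"
    by (rule finite_measure_finite_Union[symmetric])
      (use hL detour_measurable detour_disjoint(1) in \<open>auto simp: disjoint_family_on_def\<close>)
  finally have "(1 + gain) * (\<Prod>i<L. fill_prob p (k + i) * fill_prob p (Suc (k + i))) \<le>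
      prob (diagonal_steps k L) + prob (\<Union>i\<in>{..<h}. detour k L i)"
    using prob_diagonal_steps[of p k L] p1 by (simp add: distrib_right)
  also have "\<dots> = prob (with_detours k L)"
    unfolding with_detours_def h_def[symmetric]
  proof (rule finite_measure_Union[symmetric])
    have "diagonal_steps k L \<inter> detour k L i = {}" if "i < h" for i
      using detour_disjoint(2)[of i L k] that hL by simp
    then show "diagonal_steps k L \<inter> (\<Union>i\<in>{..<h}. detour k L i) = {}" by blast
  qed (use hL detour_measurable diagonal_steps_measurable in \<open>auto intro!: sets.finite_UN\<close>)
  finally show ?thesis .
qed

lemma with_detours_props:
  shows "with_detours k L \<in> sets (init_law p)" "depends_on (with_detours k L) (square (k + L) - square k)"
    "\<sigma> \<in> with_detours k L \<Longrightarrow> 0 < k \<Longrightarrow> square k \<subseteq> activated md \<sigma> \<Longrightarrow> square (k + L) \<subseteq> activated md \<sigma>"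
proof -
  have le: "i < L" if "i \<in> {..<(L + 1) div 2}" for i using that by auto
  show "with_detours k L \<in> sets (init_law p)"
    unfolding with_detours_def using le by (auto intro!: sets.finite_UN detour_measurable diagonal_steps_measurable)
  show "depends_on (with_detours k L) (square (k + L) - square k)"
    unfolding with_detours_def
    by (rule depends_on_mono[OF depends_on_Un[OF depends_diagonal_steps depends_on_UN[OF depends_detour[OF le]]]]) auto
  show "square (k + L) \<subseteq> activated md \<sigma>" if "\<sigma> \<in> with_detours k L" "0 < k" "square k \<subseteq> activated md \<sigma>"
    using that detour_grows[OF that(3,2) le] diagonal_steps_grow[OF that(3,2)] by (auto simp: with_detours_def)
qed

section \<open>Assembling the lower bound\<close>

text \<open>This belongs to the square of side \<open>k + 1\<close>: columns of lengths 1 to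
  \<open>k\<close> give the first product, the origin and then rows of lengths 2 to
  \<open>k + 1\<close> the second.\<close>

definition diagonal_prob :: "real \<Rightarrow> nat \<Rightarrow> real" where
  "diagonal_prob p k = (\<Prod>j<k. fill_prob p (Suc j)) * (\<Prod>j<Suc k. fill_prob p (Suc j))"

lemma diagonal_prob_nonneg: "0 \<le> p \<Longrightarrow> p \<le> 1 \<Longrightarrow> 0 \<le> diagonal_prob p k"
  unfolding diagonal_prob_def by (intro mult_nonneg_nonneg prod_nonneg fill_prob_nonneg ballI)

lemma diagonal_prob_lower:
  assumes "0 < p" "p < 1"
  shows "exp (- 2 * (pi\<^sup>2 / 6) / p) \<le> diagonal_prob p k"
proof -
  have "exp (- 2 * (pi\<^sup>2 / 6) / p) = exp (- (pi\<^sup>2 / 6) / p) * exp (- (pi\<^sup>2 / 6) / p)"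
    by (simp add: exp_add[symmetric])
  also have "\<dots> \<le> diagonal_prob p k"
    unfolding diagonal_prob_def
    by (intro mult_mono prod_fill_prob_lower assms prod_nonneg) (use assms in \<open>auto intro: fill_prob_nonneg\<close>)
  finally show ?thesis .
qed

lemma diagonal_prob_add:
  "diagonal_prob p (k + L) = diagonal_prob p k * (\<Prod>i<L. fill_prob p (Suc k + i) * fill_prob p (Suc (Suc k + i)))"
  by (induction L) (simp_all add: diagonal_prob_def)

lemma grown_diagonal:
  assumes "0 \<le> p" "p \<le> 1" "0 \<le> c" "grown md p (Suc k) (c * diagonal_prob p k)"
  shows "grown md p (Suc k + L) (c * diagonal_prob p (k + L))"
proof -
  have "grown md p (Suc k + L) (c * diagonal_prob p k * (\<Prod>i<L. fill_prob p (Suc k + i) * fill_prob p (Suc (Suc k + i))))"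
  proof (rule grown_extend[OF assms(4) _ diagonal_steps_measurable depends_diagonal_steps])
    show "square (Suc k + L) \<subseteq> activated md \<sigma>"
      if "\<sigma> \<in> diagonal_steps (Suc k) L" "square (Suc k) \<subseteq> activated md \<sigma>" for \<sigma>
      by (rule diagonal_steps_grow[OF that(2) _ that(1)]) simp
  qed (use assms diagonal_prob_nonneg[of p k] in
      \<open>auto simp: prob_diagonal_steps intro!: prod_nonneg mult_nonneg_nonneg fill_prob_nonneg\<close>)
  then show ?thesis by (simp add: diagonal_prob_add mult.assoc)
qed

lemma grown_block:
  assumes p: "0 < p" "p \<le> 1 / 4" and L: "1 / sqrt p \<le> L" "L \<le> 2 / sqrt p"
    and k: "1 / p \<le> Suc k" "Suc k + L \<le> 3 / p"
    and c: "0 \<le> c" and "grown md p (Suc k) (c * diagonal_prob p k)"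
  shows "grown md p (Suc k + L) (c * (1 + gain) * diagonal_prob p (k + L))"
proof -
  have "grown md p (Suc k + L) (c * diagonal_prob p k *
     ((1 + gain) * (\<Prod>i<L. fill_prob p (Suc k + i) * fill_prob p (Suc (Suc k + i)))))"
  proof (rule grown_extend[OF assms(8) _ with_detours_props(1,2) prob_with_detours])
    show "square (Suc k + L) \<subseteq> activated md \<sigma>"
      if "\<sigma> \<in> with_detours (Suc k) L" "square (Suc k) \<subseteq> activated md \<sigma>" for \<sigma>
      by (rule with_detours_props(3)[OF that(1) _ that(2)]) simp
    show "0 \<le> (1 + gain) * (\<Prod>i<L. fill_prob p (Suc k + i) * fill_prob p (Suc (Suc k + i)))"
      using p by (intro mult_nonneg_nonneg prod_nonneg) (auto simp: gain_def intro!: fill_prob_nonneg add_nonneg_nonneg)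
  qed (use assms diagonal_prob_nonneg[of p k] in auto)
  then show ?thesis by (simp add: diagonal_prob_add mult_ac)
qed

text \<open>Beyond side \<open>N\<close> the failures of all later diagonal steps have total
  probability at most \<open>2 (1-p)^N / p\<close>, hence at most 1/2. These steps look only outside
  the square, so they are independent of its growth.\<close>

lemma prob_growth_ge_half:
  assumes p: "0 < p" "p < 1" and N: "0 < N" "(1 - p) ^ N \<le> p / 4" and g: "grown md p N v" "0 \<le> v"
  shows "v / 2 \<le> prob_growth md p"
proof -
  interpret prob_space "init_law p" by (rule prob_space_init_law)
  obtain X where X: "X \<in> events" "depends_on X (square N)" "v \<le> prob X"
    "\<And>\<sigma>. \<sigma> \<in> X \<Longrightarrow> \<sigma> (0, 0) \<noteq> Occupied \<Longrightarrow> square N \<subseteq> activated md \<sigma>"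
    using g(1) unfolding grown_def by blast
  define Y where "Y = (\<Inter>j. diagonal_step (N + j))"
  have Y: "Y \<in> events" unfolding Y_def by (intro sets.countable_INT') (auto simp: diagonal_step_measurable)
  have dY: "depends_on Y (- square N)"
    unfolding Y_def
    by (rule depends_on_mono[OF depends_on_INT[OF depends_diagonal_step]]) (auto simp: rect_def)
  have bad: "prob (- diagonal_step (N + j)) \<le> 2 * (1 - p) ^ N * (1 - p) ^ j" for j
  proof -
    have "prob (- diagonal_step (N + j)) = 1 - fill_prob p (N + j) * fill_prob p (Suc (N + j))"
      using prob_compl[OF diagonal_step_measurable, of "N + j"] prob_diagonal_step[of p "N + j"] p
      by (simp add: Compl_eq_Diff_UNIV)
    also have "\<dots> \<le> 1 - fill_prob p (N + j) * fill_prob p (N + j)"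
      using p by (intro diff_left_mono mult_left_mono fill_prob_mono fill_prob_nonneg) auto
    also have "\<dots> = 2 * (1 - p) ^ (N + j) - ((1 - p) ^ (N + j)) ^ 2"
      by (simp add: fill_prob_def algebra_simps power2_eq_square)
    also have "\<dots> \<le> 2 * (1 - p) ^ (N + j)" by simp
    finally show ?thesis by (simp add: power_add)
  qed
  have sums: "(\<lambda>j. 2 * (1 - p) ^ N * (1 - p) ^ j) sums (2 * (1 - p) ^ N * (1 / (1 - (1 - p))))"
    by (intro sums_mult geometric_sums) (use p in simp)
  have summ: "summable (\<lambda>j. prob (- diagonal_step (N + j)))"
    by (rule summable_comparison_test'[OF sums_summable[OF sums], of 0]) (use bad in simp)
  have "prob (- Y) = prob (\<Union>j. - diagonal_step (N + j))" unfolding Y_def by (simp add: Compl_INT)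
  also have "\<dots> \<le> (\<Sum>j. prob (- diagonal_step (N + j)))"
  proof (rule finite_measure_subadditive_countably[OF _ summ])
    have "- diagonal_step j \<in> events" for j
      using sets.compl_sets[OF diagonal_step_measurable[of j p]] by (simp add: Compl_eq_Diff_UNIV)
    then show "range (\<lambda>j. - diagonal_step (N + j)) \<subseteq> events" by auto
  qed
  also have "\<dots> \<le> 2 * (1 - p) ^ N * (1 / (1 - (1 - p)))"
    using bad by (intro sums_le[OF _ summable_sums[OF summ] sums]) auto
  also have "\<dots> \<le> 1 / 2" using N(2) p by (simp add: field_simps)
  finally have "1 / 2 \<le> prob Y" using prob_compl[OF Y] by (simp add: Compl_eq_Diff_UNIV)
  then have "v * (1 / 2) \<le> prob X * prob Y" using X(3) g(2) by (intro mult_mono) auto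
  also have "\<dots> = prob (X \<inter> Y)"
    by (rule indep_depends_on[OF X(1,2) Y dY, symmetric]) auto
  also have "\<dots> \<le> prob {\<sigma>. indefinite_growth md \<sigma>}"
  proof (rule finite_measure_mono_AE)
    have cols: "AE \<sigma> in init_law p. \<forall>x. \<sigma> \<in> some_filled ({x} \<times> {0..})"
    proof (subst AE_all_countable, intro allI)
      fix x show "AE \<sigma> in init_law p. \<sigma> \<in> some_filled ({x} \<times> {0..})"
        by (rule AE_some_filled[where f="\<lambda>n. (x, int n)"]) (use p in \<open>auto intro: injI\<close>)
    qed
    have rows: "AE \<sigma> in init_law p. \<forall>y. \<sigma> \<in> some_filled ({0..} \<times> {y})"
    proof (subst AE_all_countable, intro allI)
      fix y show "AE \<sigma> in init_law p. \<sigma> \<in> some_filled ({0..} \<times> {y})"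
        by (rule AE_some_filled[where f="\<lambda>n. (int n, y)"]) (use p in \<open>auto intro: injI\<close>)
    qed
    show "AE \<sigma> in init_law p. \<sigma> \<in> X \<inter> Y \<longrightarrow> \<sigma> \<in> {\<sigma>. indefinite_growth md \<sigma>}"
      using AE_only_origin_active[of p] cols rows
    proof eventually_elim
      fix \<sigma> assume 1: "\<forall>x. (\<sigma> x = Active \<longrightarrow> x = (0, 0)) \<and> (\<sigma> x = Occupied \<longrightarrow> x \<noteq> (0, 0))"
        "\<forall>x. \<sigma> \<in> some_filled ({x} \<times> {0..})" "\<forall>y. \<sigma> \<in> some_filled ({0..} \<times> {y})"
      show "\<sigma> \<in> X \<inter> Y \<longrightarrow> \<sigma> \<in> {\<sigma>. indefinite_growth md \<sigma>}"
      proof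
        assume \<sigma>: "\<sigma> \<in> X \<inter> Y"
        then have base: "square N \<subseteq> activated md \<sigma>" using X(4) 1(1) by blast
        have large: "square (N + j) \<subseteq> activated md \<sigma>" for j
          by (rule diagonal_steps_grow[OF base N(1)]) (use \<sigma> in \<open>auto simp: Y_def diagonal_steps_def\<close>)
        have "square k \<subseteq> activated md \<sigma>" for k
          using large[of k] by (auto simp: rect_def)
        then show "\<sigma> \<in> {\<sigma>. indefinite_growth md \<sigma>}" using plane_from_quadrant 1(2,3) by blast
      qed
    qed
  qed (rule growth_measurable)
  finally show ?thesis by (simp add: prob_growth_def)
qed

lemma prob_growth_lower_gain:
  assumes p: "0 < p" "p \<le> 1 / 16"
  shows "(1 + gain) powr (1 / (4 * sqrt p)) * exp (- 2 * (pi\<^sup>2 / 6) / p) / 2 \<le> prob_growth md p"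
proof -
  define L where "L = nat \<lceil>1 / sqrt p\<rceil>"
  define K where "K = nat \<lceil>1 / p\<rceil>"
  \<comment> \<open>About half of \<open>1 / sqrt p\<close> blocks, because \<open>L\<close> may be
    as large as \<open>2 / sqrt p\<close>: then \<open>B * L <= 1/p\<close>, and all blocks end
    before side length \<open>3/p\<close>.\<close>
  define B where "B = nat \<lfloor>1 / (2 * sqrt p)\<rfloor>"
  have p1: "0 \<le> p" "p \<le> 1" "p < 1" "p \<le> 1 / 4" using p by auto
  have s4: "sqrt p \<le> 1 / 4" using p by (intro real_le_lsqrt) (auto simp: power2_eq_square)
  then have four: "4 \<le> 1 / sqrt p" using p by (simp add: field_simps)
  have L: "1 / sqrt p \<le> L" "L \<le> 2 / sqrt p" unfolding L_def using four by linarith+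
  have K: "1 / p \<le> K" "K \<le> 1 / p + 1" unfolding K_def using p by (auto intro: of_nat_ceiling)
  have half: "1 / (2 * sqrt p) = (1 / sqrt p) / 2" by simp
  have B: "1 / (4 * sqrt p) \<le> B" "B \<le> 1 / (2 * sqrt p)"
    unfolding B_def half using four by (auto simp: field_simps) linarith+
  have BL: "real B * real L \<le> 1 / p"
  proof -
    have "real B * real L \<le> (1 / (2 * sqrt p)) * (2 / sqrt p)" using B L p by (intro mult_mono) auto
    also have "\<dots> = 1 / p" using p by simp
    finally show ?thesis .
  qed
  have gain: "0 < gain" by (simp add: gain_def)
  have "grown md p (Suc 0) (1 * diagonal_prob p 0)"
    using grown_Suc_0[of p md] p1 by (simp add: diagonal_prob_def)
  from grown_diagonal[OF p1(1,2) _ this, of K]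
  have start: "grown md p (Suc K) (1 * diagonal_prob p K)" by simp
  have blocks: "grown md p (Suc K + b * L) ((1 + gain) ^ b * diagonal_prob p (K + b * L))" if "b \<le> B" for b
    using that
  proof (induction b)
    case 0
    show ?case using start by simp
  next
    case (Suc b)
    have "real (Suc b) * L \<le> real B * L" using Suc.prems by (intro mult_right_mono) auto
    then have "real (Suc b * L) \<le> 1 / p" using BL unfolding of_nat_mult by linarith
    moreover have "2 \<le> 1 / p" using p by (simp add: field_simps)
    ultimately have "real (Suc (K + b * L) + L) \<le> 3 / p" using K by simp
    moreover have "1 / p \<le> Suc (K + b * L)"
      using K(1) of_nat_mono[of K "Suc (K + b * L)", where ?'a = real] by linarith
    ultimately have "grown md p (Suc (K + b * L) + L) ((1 + gain) ^ b * (1 + gain) * diagonal_prob p (K + b * L + L))"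
      using Suc gain by (intro grown_block[OF p(1) p1(4) L]) auto
    then show ?case by (simp add: algebra_simps)
  qed
  obtain N0 where N0: "(1 - p) ^ N0 \<le> p / 4"
    using real_arch_pow_inv[of "p / 4" "1 - p"] p by (auto intro: less_imp_le)
  define N where "N = Suc (K + B * L) + N0"
  have "(1 - p) ^ N \<le> (1 - p) ^ N0" using p by (intro power_decreasing) (auto simp: N_def)
  then have N: "0 < N" "(1 - p) ^ N \<le> p / 4" using N0 by (auto simp: N_def)
  have "grown md p N ((1 + gain) ^ B * diagonal_prob p (K + B * L + N0))"
    unfolding N_def using blocks[of B] gain p1 by (intro grown_diagonal) auto
  then have "(1 + gain) ^ B * diagonal_prob p (K + B * L + N0) / 2 \<le> prob_growth md p"
    using gain p1 p diagonal_prob_nonneg[of p] by (intro prob_growth_ge_half[OF p(1) p1(3) N]) auto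
  moreover have "(1 + gain) powr (1 / (4 * sqrt p)) * exp (- 2 * (pi\<^sup>2 / 6) / p) \<le>
      (1 + gain) ^ B * diagonal_prob p (K + B * L + N0)"
  proof (intro mult_mono diagonal_prob_lower)
    have "(1 + gain) powr (1 / (4 * sqrt p)) \<le> (1 + gain) powr B"
      using B(1) gain by (intro powr_mono) auto
    then show "(1 + gain) powr (1 / (4 * sqrt p)) \<le> (1 + gain) ^ B"
      using gain by (simp add: powr_realpow)
  qed (use p gain in auto)
  ultimately show ?thesis by simp
qed

lemma prob_growth_lower:
  obtains c p0 where "0 < c" "0 < p0"
    "\<And>md p. 0 < p \<Longrightarrow> p < p0 \<Longrightarrow> exp ((- 2 * (pi\<^sup>2 / 6) + c * sqrt p) / p) \<le> prob_growth md p"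
proof -
  \<comment> \<open>Half of the coefficient \<open>ln (1 + gain) / 4\<close> that the blocks
    provide; the other half pays for the factor 1/2 once \<open>sqrt p < c\<close>.\<close>
  define c where "c = ln (1 + gain) / 8"
  have gain: "0 < gain" by (simp add: gain_def)
  have c: "0 < c" unfolding c_def using gain by simp
  have "exp ((- 2 * (pi\<^sup>2 / 6) + c * sqrt p) / p) \<le> prob_growth md p"
    if p: "0 < p" "p < min (1 / 16) (c\<^sup>2)" for md p
  proof -
    have "sqrt p < c" using p c by (simp add: real_less_lsqrt)
    then have cs: "1 \<le> c / sqrt p" using p by (simp add: field_simps)
    have sp: "sqrt p / p = 1 / sqrt p" using p by (metis less_imp_le real_div_sqrt inverse_divide inverse_eq_divide)
    have "(- 2 * (pi\<^sup>2 / 6) + c * sqrt p) / p = - 2 * (pi\<^sup>2 / 6) / p + c * (sqrt p / p)"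
      by (simp add: add_divide_distrib diff_divide_distrib)
    also have "\<dots> = - 2 * (pi\<^sup>2 / 6) / p + c / sqrt p" by (simp add: sp)
    also have "\<dots> \<le> (2 * c / sqrt p - 1) + - 2 * (pi\<^sup>2 / 6) / p" using cs by simp
    finally have "exp ((- 2 * (pi\<^sup>2 / 6) + c * sqrt p) / p) \<le> exp ((2 * c / sqrt p - 1) + - 2 * (pi\<^sup>2 / 6) / p)" by simp
    also have "\<dots> = exp (2 * c / sqrt p) * exp (- 1) * exp (- 2 * (pi\<^sup>2 / 6) / p)"
      by (simp add: exp_add[symmetric])
    also have "\<dots> \<le> exp (2 * c / sqrt p) * (1 / 2) * exp (- 2 * (pi\<^sup>2 / 6) / p)"
    proof (intro mult_right_mono mult_left_mono)
      show "exp (- 1) \<le> (1 / 2 :: real)" using exp_ge_add_one_self[of "1 :: real"] by (simp add: exp_minus field_simps)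
    qed auto
    also have "exp (2 * c / sqrt p) = (1 + gain) powr (1 / (4 * sqrt p))"
      using gain by (simp add: powr_def c_def)
    also have "\<dots> * (1 / 2) * exp (- 2 * (pi\<^sup>2 / 6) / p) \<le> prob_growth md p"
      using prob_growth_lower_gain[of p md] p by simp
    finally show ?thesis .
  qed
  then show thesis using that[of c "min (1 / 16) (c\<^sup>2)"] c by simp
qed

theorem theorem3:
  shows "(\<forall>m::model. \<exists>c C p0::real. c > 0 \<and> C > 0 \<and> p0 > 0 \<and>
           (\<forall>p. 0 < p \<and> p < p0 \<longrightarrow>
              exp ((- 2 * (pi\<^sup>2 / 6) + c * sqrt p) / p) \<le> prob_growth m p \<and>
              prob_growth m p \<le> exp ((- 2 * (pi\<^sup>2 / 6) + C * sqrt p * (ln (1 / p)) ^ 3) / p)))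
       \<and> (\<exists>C p0::real. C > 0 \<and> p0 > 0 \<and>
           (\<forall>p. 0 < p \<and> p < p0 \<longrightarrow>
              prob_growth Frobose p \<le> exp ((- 2 * (pi\<^sup>2 / 6) + C * sqrt p * (ln (1 / p)) ^ 2) / p)))"
proof (intro conjI allI)
  show "\<exists>C p0::real. C > 0 \<and> p0 > 0 \<and> (\<forall>p. 0 < p \<and> p < p0 \<longrightarrow>
      prob_growth Frobose p \<le> exp ((- 2 * (pi\<^sup>2 / 6) + C * sqrt p * (ln (1 / p)) ^ 2) / p))"
    by (intro exI[of _ 1540] exI[of _ "1 / 4"]) (use prob_growth_upper in simp)
next
  fix m
  obtain c p1 where c: "0 < c" "0 < p1"
    "\<And>md p. 0 < p \<Longrightarrow> p < p1 \<Longrightarrow> exp ((- 2 * (pi\<^sup>2 / 6) + c * sqrt p) / p) \<le> prob_growth md p"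
    by (rule prob_growth_lower) blast
  \<comment> \<open>The quadratic bound holds for both models; for \<open>p < 1/4\<close> the
    logarithm is at least 1, so the cubic bound follows.\<close>
  have upper: "prob_growth m p \<le> exp ((- 2 * (pi\<^sup>2 / 6) + 1540 * sqrt p * (ln (1 / p)) ^ 3) / p)"
    if p: "0 < p" "p < 1 / 4" for p
  proof -
    have "4 \<le> 1 / p" using p by (simp add: field_simps)
    then have "exp 1 \<le> 1 / p" using exp_le by linarith
    then have "1 \<le> ln (1 / p)" using p by (simp add: ln_ge_iff)
    then have "(ln (1 / p)) ^ 2 \<le> (ln (1 / p)) ^ 3" by (intro power_increasing) auto
    then have "(- 2 * (pi\<^sup>2 / 6) + 1540 * sqrt p * (ln (1 / p)) ^ 2) / p
        \<le> (- 2 * (pi\<^sup>2 / 6) + 1540 * sqrt p * (ln (1 / p)) ^ 3) / p"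
      using p by (intro divide_right_mono add_left_mono mult_left_mono) auto
    then show ?thesis using prob_growth_upper[OF p, of m] by (meson exp_le_cancel_iff order_trans)
  qed
  show "\<exists>c C p0::real. c > 0 \<and> C > 0 \<and> p0 > 0 \<and> (\<forall>p. 0 < p \<and> p < p0 \<longrightarrow>
      exp ((- 2 * (pi\<^sup>2 / 6) + c * sqrt p) / p) \<le> prob_growth m p \<and>
      prob_growth m p \<le> exp ((- 2 * (pi\<^sup>2 / 6) + C * sqrt p * (ln (1 / p)) ^ 3) / p))"
  proof (intro exI conjI allI impI)
    fix p :: real assume "0 < p \<and> p < min p1 (1 / 4)"
    then show "exp ((- 2 * (pi\<^sup>2 / 6) + c * sqrt p) / p) \<le> prob_growth m p"
      "prob_growth m p \<le> exp ((- 2 * (pi\<^sup>2 / 6) + 1540 * sqrt p * (ln (1 / p)) ^ 3) / p)"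
      using c(3) upper by auto
  qed (use c(1,2) in auto)
qed

end
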